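(* Let $\alpha,\beta>0$ and let $g\in L^2(\Lambda\times\mathbb{R})$. Suppose that the system $$\widehat{\mathcal U}(g,\alpha,\beta,1)=\{\hat D_j\hat T_{k,l,m}g: j\in\mathbb{Z},\ k\in\alpha\mathbb{Z},\ l\in\beta\mathbb{Z},\ m\in\mathbb{Z}\}$$ is a frame for $L^2(\Lambda\times\mathbb{R})$ with frame bounds $A,B$. Then $$A\,\alpha\beta\ln 2\le\int_0^\infty\int_{\mathbb{R}}|g(\lambda,t)|^2\,\lambda^{-1}\,dt\,d\lambda\le B\,\alpha\beta\ln 2$$ and $$A\,\alpha\beta\ln 2\le\int_{-\infty}^0\int_{\mathbb{R}}|g(\lambda,t)|^2\,|\lambda|^{-1}\,dt\,d\lambda\le B\,\alpha\beta\ln 2.$$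
   Context: $\Lambda=\mathbb{R}\setminus\{0\}$, and $L^2(\Lambda\times\mathbb{R})$ is taken with respect to the measure $|\lambda|\,d\lambda\,dt$. For real $k,l,m$, $\hat T_{k,l,m}g(\lambda,t)=e^{2\pi i\lambda m}e^{-2\pi i\lambda l t}g(\lambda,t-k)$; for $j\in\mathbb{Z}$, $\hat D_jg(\lambda,t)=2^{3j/4}g(2^j\lambda,2^{-j/2}t)$ (a unitary operator). A system $\{\psi_i\}$ in a Hilbert space $\mathcal{H}$ is a frame with frame bounds $0<A\le B<\infty$ if $A\|f\|^2\le\sum_i|\langle f,\psi_i\rangle|^2\le B\|f\|^2$ for all $f\in\mathcal{H}$. *)

theory Defs
  imports "HOL-Analysis.Analysis"
begin

text \<open>Elements of \<open>L\<^sup>2(M)\<close> are represented by functions rather than by classes of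
  functions that agree almost everywhere.\<close>

definition L2 :: "'a measure \<Rightarrow> ('a \<Rightarrow> complex) set" where
  "L2 M = {f \<in> borel_measurable M. integrable M (\<lambda>x. (cmod (f x))\<^sup>2)}"

definition L2_inner :: "'a measure \<Rightarrow> ('a \<Rightarrow> complex) \<Rightarrow> ('a \<Rightarrow> complex) \<Rightarrow> complex" where
  "L2_inner M f g = (LINT x|M. f x * cnj (g x))"

definition L2_norm :: "'a measure \<Rightarrow> ('a \<Rightarrow> complex) \<Rightarrow> real" where
  "L2_norm M f = sqrt (LINT x|M. (cmod (f x))\<^sup>2)"

text \<open>A frame is an indexed family, so repeated members count with multiplicity. Summability is
  required explicitly because \<^const>\<open>infsum\<close> is \<open>0\<close> on families that are not summable.\<close>

definition L2_frame ::
  "'a measure \<Rightarrow> 'i set \<Rightarrow> ('i \<Rightarrow> 'a \<Rightarrow> complex) \<Rightarrow> real \<Rightarrow> real \<Rightarrow> bool" where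
  "L2_frame M I \<psi> A B \<longleftrightarrow>
     (\<forall>i\<in>I. \<psi> i \<in> L2 M) \<and> 0 < A \<and> A \<le> B \<and>
     (\<forall>f\<in>L2 M.
        (\<lambda>i. (cmod (L2_inner M f (\<psi> i)))\<^sup>2) summable_on I \<and>
        A * (L2_norm M f)\<^sup>2 \<le> (\<Sum>\<^sub>\<infinity>i\<in>I. (cmod (L2_inner M f (\<psi> i)))\<^sup>2) \<and>
        (\<Sum>\<^sub>\<infinity>i\<in>I. (cmod (L2_inner M f (\<psi> i)))\<^sup>2) \<le> B * (L2_norm M f)\<^sup>2)"

definition Lam :: "real set" where
  "Lam = UNIV - {0}"

text \<open>The measure \<open>|x| dx dt\<close> on \<open>\<Lambda> \<times> \<real>\<close>; the frequency variable \<open>\<lambda>\<close> is written \<open>x\<close> throughout.\<close>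

definition LamR :: "(real \<times> real) measure" where
  "LamR = density (restrict_space lborel (Lam \<times> UNIV)) (\<lambda>(x, t). ennreal \<bar>x\<bar>)"

definition That ::
  "real \<Rightarrow> real \<Rightarrow> real \<Rightarrow> (real \<times> real \<Rightarrow> complex) \<Rightarrow> real \<times> real \<Rightarrow> complex" where
  "That k l m g = (\<lambda>(x, t). exp (2 * pi * \<i> * x * m) * exp (- 2 * pi * \<i> * x * l * t) * g (x, t - k))"

definition Dhat :: "int \<Rightarrow> (real \<times> real \<Rightarrow> complex) \<Rightarrow> real \<times> real \<Rightarrow> complex" where
  "Dhat j g = (\<lambda>(x, t). of_real (2 powr (3 * of_int j / 4)) *
                 g (2 powi j * x, 2 powr (- of_int j / 2) * t))"

definition scaled_ints :: "real \<Rightarrow> real set" where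
  "scaled_ints a = range (\<lambda>n::int. a * of_int n)"

definition Uhat_index :: "real \<Rightarrow> real \<Rightarrow> real \<Rightarrow> (int \<times> real \<times> real \<times> real) set" where
  "Uhat_index \<alpha> \<beta> \<gamma> = UNIV \<times> scaled_ints \<alpha> \<times> scaled_ints \<beta> \<times> scaled_ints \<gamma>"

definition Uhat ::
  "(real \<times> real \<Rightarrow> complex) \<Rightarrow> int \<times> real \<times> real \<times> real \<Rightarrow> real \<times> real \<Rightarrow> complex" where
  "Uhat g = (\<lambda>(j, k, l, m). Dhat j (That k l m g))"

end

theory Submission
  imports Defs "HOL-Probability.Characteristic_Functions" "HOL-Real_Asymp.Real_Asymp"
begin

text \<open>Pair a function \<open>f\<close>, moved by the Heisenberg operator \<open>That p q r\<close>, with the members of the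
  system that belong to one scale \<open>j\<close>. Since \<open>Uhat g (j, k, l, m)\<close> is a Heisenberg translate of
  \<open>Dhat j g\<close>, the sum of the squared coefficients is the sum of
  \<open>\<Phi> j (p, q, r) = \<bar>\<langle>That p q r f, Dhat j g\<rangle>\<bar>\<^sup>2\<close> over a set of lattice type, whose steps in the three
  coordinates are \<open>2\<^bsup>j/2\<^esup>\<alpha>\<close>, \<open>2\<^bsup>j/2\<^esup>\<beta>\<close> and \<open>2\<^sup>j\<close> (lemma \<open>coeff_lattice\<close>). Averaged over all
  \<open>(p, q, r)\<close>, such a sum becomes the integral of \<open>\<Phi> j\<close> over space divided by the cell volume
  \<open>2\<^bsup>2j\<^esup>\<alpha>\<beta>\<close>. The orthogonality relations of the Heisenberg group, here two applications of
  Plancherel's identity in one variable, evaluate that integral: it is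
  \<open>\<integral> \<bar>x\<bar> \<parallel>f(x,\<cdot>)\<parallel>\<^sup>2 \<parallel>Dhat j g (x,\<cdot>)\<parallel>\<^sup>2 dx\<close>, and \<open>\<parallel>Dhat j g (x,\<cdot>)\<parallel>\<^sup>2 = 2\<^bsup>2j\<^esup> \<parallel>g(2\<^sup>jx,\<cdot>)\<parallel>\<^sup>2\<close>. The powers of
  two cancel. The frame inequality for the moved functions, which all have the norm of \<open>f\<close>, thus
  turns formally into
  \<open>A \<parallel>f\<parallel>\<^sup>2 \<le> (\<alpha>\<beta>)\<^sup>-\<^sup>1 \<Sum>\<^sub>j \<integral> \<bar>x\<bar> \<parallel>f(x,\<cdot>)\<parallel>\<^sup>2 \<parallel>g(2\<^sup>jx,\<cdot>)\<parallel>\<^sup>2 dx \<le> B \<parallel>f\<parallel>\<^sup>2\<close>.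
  For a function with \<open>\<parallel>f(x,\<cdot>)\<parallel> = 1/\<bar>x\<bar>\<close> on the octave \<open>1 \<le> x < 2\<close> and \<open>0\<close> elsewhere, the squared
  norm is \<open>ln 2\<close>, and the dilates of the octave tile the half-line, so that the middle term is
  \<open>(\<alpha>\<beta>)\<^sup>-\<^sup>1 \<integral>\<^sub>0\<^sup>\<infinity> \<parallel>g(x,\<cdot>)\<parallel>\<^sup>2 dx/x\<close>. The octave \<open>-2 < x \<le> -1\<close> gives the other half-line.\<close>

text \<open>The average has to be taken over boxes \<open>[0, R)\<^sup>3\<close> that serve all scales at once, although for
  large \<open>j\<close> the cells are larger than the box. Counting lattice points in one coordinate shows
  that the averaged sum at scale \<open>j\<close> is at most \<open>\<Prod> (1/c\<^sub>i + 1/R)\<close> times the integral of \<open>\<Phi> j\<close>, where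
  the \<open>c\<^sub>i\<close> are the three steps, and at least \<open>\<Prod> (1/c\<^sub>i - 1/R)\<close> times that integral once \<open>R\<close> exceeds
  all steps (\<open>mean_upper\<close>, \<open>mean_lower\<close>). For the bound
  with \<open>B\<close>, Fatou's lemma over \<open>j\<close> suffices. For the bound with \<open>A\<close>, the excess at scale \<open>j\<close> is
  \<open>O(1/R)\<close> times \<open>(1 + 2\<^bsup>2j\<^esup>) \<integral> \<bar>x\<bar> \<parallel>f(x,\<cdot>)\<parallel>\<^sup>2 \<parallel>g(2\<^sup>jx,\<cdot>)\<parallel>\<^sup>2 dx\<close> (\<open>covolume_error_bound\<close>). These numbers
  have a finite sum over \<open>j\<close>: without the factor \<open>2\<^bsup>2j\<^esup>\<close> by the bound with \<open>B\<close>, and with it because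
  \<open>2\<^sup>j \<le> \<bar>y\<bar>\<close> on the \<open>j\<close>-th dilate of the octave, so that the sum is at most the squared norm of \<open>g\<close>
  (\<open>sum_weighted_octave_mass_finite\<close>).\<close>

section \<open>Continuity of translations in the mean\<close>

text \<open>Phrased with sequences, so that it can be fed directly into dominated convergence.\<close>

definition L1_translation_continuous :: "(real \<Rightarrow> real) \<Rightarrow> bool" where
  "L1_translation_continuous v \<longleftrightarrow>
     (\<forall>s. s \<longlonglongrightarrow> 0 \<longrightarrow> (\<lambda>n::nat. LINT x|lborel. \<bar>v (x - s n) - v x\<bar>) \<longlonglongrightarrow> 0)"

lemma integrable_translate:
  fixes v :: "real \<Rightarrow> 'a::{banach, second_countable_topology}"
  assumes "integrable lborel v"
  shows "integrable lborel (\<lambda>x. v (x - s))"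
  using lborel_integrable_real_affine[OF assms, of 1 "-s"] by simp

lemma integral_translate:
  fixes v :: "real \<Rightarrow> 'a::{banach, second_countable_topology}"
  shows "(LINT x|lborel. v (x - s)) = integral\<^sup>L lborel v"
  using lborel_integral_real_affine[of 1 v "-s"] by simp

lemma L1_translation_continuous_approx:
  assumes v: "integrable lborel v"
    and approx: "\<And>e. e > 0 \<Longrightarrow> \<exists>w. integrable lborel w \<and> L1_translation_continuous w \<and>
                   (LINT x|lborel. \<bar>v x - w x\<bar>) \<le> e"
  shows "L1_translation_continuous v"
  unfolding L1_translation_continuous_def
proof (intro allI impI)
  fix s :: "nat \<Rightarrow> real" assume s: "s \<longlonglongrightarrow> 0"
  show "(\<lambda>n. LINT x|lborel. \<bar>v (x - s n) - v x\<bar>) \<longlonglongrightarrow> 0"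
  proof (rule LIMSEQ_I)
    fix r :: real assume "r > 0"
    then obtain w where w: "integrable lborel w" "L1_translation_continuous w"
      and vw: "(LINT x|lborel. \<bar>v x - w x\<bar>) \<le> r / 4"
      using approx[of "r/4"] by auto
    have "(\<lambda>n. LINT x|lborel. \<bar>w (x - s n) - w x\<bar>) \<longlonglongrightarrow> 0"
      using w s by (simp add: L1_translation_continuous_def)
    from LIMSEQ_D[OF this, of "r/2"] \<open>r > 0\<close> obtain N where
      N: "\<And>n. n \<ge> N \<Longrightarrow> \<bar>LINT x|lborel. \<bar>w (x - s n) - w x\<bar>\<bar> < r / 2"
      by auto
    show "\<exists>N. \<forall>n\<ge>N. norm ((LINT x|lborel. \<bar>v (x - s n) - v x\<bar>) - 0) < r"
    proof (intro exI allI impI)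
      fix n assume "n \<ge> N"
      note [simp] = v w(1) integrable_translate
      have d: "integrable lborel (\<lambda>x. \<bar>v x - w x\<bar>)" by simp
      have "(LINT x|lborel. \<bar>v (x - s n) - v x\<bar>) \<le>
         (LINT x|lborel. \<bar>v (x - s n) - w (x - s n)\<bar> + \<bar>w (x - s n) - w x\<bar> + \<bar>v x - w x\<bar>)"
        by (intro integral_mono) auto
      also have "\<dots> = (LINT x|lborel. \<bar>v (x - s n) - w (x - s n)\<bar>)
          + (LINT x|lborel. \<bar>w (x - s n) - w x\<bar>) + (LINT x|lborel. \<bar>v x - w x\<bar>)"
        by simp
      also have "(LINT x|lborel. \<bar>v (x - s n) - w (x - s n)\<bar>) = (LINT x|lborel. \<bar>v x - w x\<bar>)"
        using integral_translate[of "\<lambda>x. \<bar>v x - w x\<bar>"] .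
      finally have "(LINT x|lborel. \<bar>v (x - s n) - v x\<bar>) < r"
        using vw N[OF \<open>n \<ge> N\<close>] by linarith
      moreover have "0 \<le> (LINT x|lborel. \<bar>v (x - s n) - v x\<bar>)" by simp
      ultimately show "norm ((LINT x|lborel. \<bar>v (x - s n) - v x\<bar>) - 0) < r" by simp
    qed
  qed
qed

lemma L1_translation_continuous_add:
  assumes "integrable lborel v" "integrable lborel w"
    and v: "L1_translation_continuous v" and w: "L1_translation_continuous w"
  shows "L1_translation_continuous (\<lambda>x. v x + w x)"
  unfolding L1_translation_continuous_def
proof (intro allI impI)
  fix s :: "nat \<Rightarrow> real" assume s: "s \<longlonglongrightarrow> 0"
  note [simp] = assms(1,2) integrable_translate
  have lim: "(\<lambda>n. (LINT x|lborel. \<bar>v (x - s n) - v x\<bar>) + (LINT x|lborel. \<bar>w (x - s n) - w x\<bar>)) \<longlonglongrightarrow> 0"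
    using v w s by (auto simp: L1_translation_continuous_def intro!: tendsto_add_zero)
  show "(\<lambda>n. LINT x|lborel. \<bar>(v (x - s n) + w (x - s n)) - (v x + w x)\<bar>) \<longlonglongrightarrow> 0"
  proof (rule tendsto_sandwich[OF always_eventually always_eventually tendsto_const lim]; intro allI)
    fix n
    have "(LINT x|lborel. \<bar>(v (x - s n) + w (x - s n)) - (v x + w x)\<bar>)
       \<le> (LINT x|lborel. \<bar>v (x - s n) - v x\<bar> + \<bar>w (x - s n) - w x\<bar>)"
      by (intro integral_mono) auto
    then show "(LINT x|lborel. \<bar>(v (x - s n) + w (x - s n)) - (v x + w x)\<bar>)
       \<le> (LINT x|lborel. \<bar>v (x - s n) - v x\<bar>) + (LINT x|lborel. \<bar>w (x - s n) - w x\<bar>)"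
      by simp
  qed simp
qed

text \<open>For an open set the indicator of \<open>U \<inter> (U + s)\<close> tends to the indicator of \<open>U\<close> pointwise, because a
  point of \<open>U\<close> stays in \<open>U\<close> under small shifts. Dominated convergence then does the rest. For
  general sets pointwise convergence can fail; they are approximated by open ones below.\<close>

lemma L1_translation_continuous_open:
  assumes U: "open U" "emeasure lborel U < \<infinity>"
  shows "L1_translation_continuous (\<lambda>x. indicator U x * c)"
  unfolding L1_translation_continuous_def
proof (intro allI impI)
  fix s :: "nat \<Rightarrow> real" assume s: "s \<longlonglongrightarrow> 0"
  have [measurable]: "U \<in> sets borel" using U by auto
  have I: "integrable lborel (indicator U :: real \<Rightarrow> real)"
    using U by auto
  note [simp] = I integrable_translate[OF I]
  have J: "integrable lborel (\<lambda>x. indicator U x * indicator U (x - s n) :: real)" for n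
    by (rule Bochner_Integration.integrable_bound[OF I]) (auto simp: indicator_def)
  have lim: "(\<lambda>n. LINT x|lborel. indicator U x * indicator U (x - s n)) \<longlonglongrightarrow> (LINT x|lborel. indicator U x :: real)"
  proof (rule integral_dominated_convergence[where w="indicator U"])
    show "AE x in lborel. (\<lambda>n. indicator U x * indicator U (x - s n)) \<longlonglongrightarrow> (indicator U x :: real)"
    proof (rule AE_I2)
      fix x
      have "(\<lambda>n. x - s n) \<longlonglongrightarrow> x" using tendsto_diff[OF tendsto_const s, of x] by simp
      show "(\<lambda>n. indicator U x * indicator U (x - s n)) \<longlonglongrightarrow> (indicator U x :: real)"
      proof (cases "x \<in> U")
        case True
        then have "\<forall>\<^sub>F n in sequentially. x - s n \<in> U"
          using topological_tendstoD[OF \<open>(\<lambda>n. x - s n) \<longlonglongrightarrow> x\<close> U(1)] by auto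
        then have "\<forall>\<^sub>F n in sequentially. (indicator U x * indicator U (x - s n) :: real) = indicator U x"
          by eventually_elim (auto simp: True)
        then show ?thesis by (rule tendsto_eventually)
      qed simp
    qed
  qed (auto simp: indicator_def)
  have eq: "(LINT x|lborel. \<bar>indicator U (x - s n) * c - indicator U x * c\<bar>)
     = \<bar>c\<bar> * (2 * (LINT x|lborel. indicator U x) - 2 * (LINT x|lborel. indicator U x * indicator U (x - s n)))" for n
  proof -
    have "(LINT x|lborel. \<bar>indicator U (x - s n) * c - indicator U x * c\<bar>)
      = (LINT x|lborel. \<bar>c\<bar> * (indicator U (x - s n) + indicator U x - 2 * (indicator U x * indicator U (x - s n))))"
      by (intro Bochner_Integration.integral_cong) (auto simp: indicator_def)
    also have "\<dots> = \<bar>c\<bar> * ((LINT x|lborel. indicator U (x - s n)) + (LINT x|lborel. indicator U x) - 2 * (LINT x|lborel. indicator U x * indicator U (x - s n)))"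
      using J by simp
    also have "(LINT x|lborel. indicator U (x - s n)) = (LINT x|lborel. indicator U x :: real)"
      using integral_translate[of "indicator U :: real \<Rightarrow> real"] .
    finally show ?thesis by simp
  qed
  show "(\<lambda>n. LINT x|lborel. \<bar>indicator U (x - s n) * c - indicator U x * c\<bar>) \<longlonglongrightarrow> 0"
    unfolding eq by (rule tendsto_eq_intros lim refl | simp)+
qed

text \<open>The property passes to \<open>L\<^sup>1\<close> limits, and outer regularity of Lebesgue measure brings the indicator
  of any Borel set of finite measure within every distance of that of an open set.\<close>

lemma integrable_imp_L1_translation_continuous:
  assumes "integrable lborel v"
  shows "L1_translation_continuous v"
  using assms
proof induct
  case (base A c)
  have [measurable]: "A \<in> sets borel" using base by simp
  have IA: "integrable lborel (indicator A :: real \<Rightarrow> real)" using base by auto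
  show ?case
  proof (rule L1_translation_continuous_approx)
    fix e :: real assume "e > 0"
    then have "e / (\<bar>c\<bar> + 1) > 0" by (simp add: add_nonneg_pos)
    with outer_regular_lborel[of A] obtain U where
      U: "open U" "A \<subseteq> U" "emeasure lborel (U - A) < e / (\<bar>c\<bar> + 1)"
      by (metis \<open>A \<in> sets borel\<close>)
    have [measurable]: "U \<in> sets borel" using U by auto
    have "emeasure lborel U = emeasure lborel A + emeasure lborel (U - A)"
      using U by (subst plus_emeasure) (auto simp: Un_absorb1)
    then have fin: "emeasure lborel U < \<infinity>"
      using U base by (auto simp: less_top[symmetric])
    have IU: "integrable lborel (indicator U :: real \<Rightarrow> real)" using fin by auto
    have "(LINT x|lborel. \<bar>indicator A x *\<^sub>R c - indicator U x * c\<bar>)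
        = (LINT x|lborel. \<bar>c\<bar> * indicator (U - A) x)"
      using U by (intro Bochner_Integration.integral_cong) (auto simp: indicator_def)
    also have "\<dots> = \<bar>c\<bar> * measure lborel (U - A)" by simp
    also have "\<dots> \<le> \<bar>c\<bar> * (e / (\<bar>c\<bar> + 1))"
    proof (rule mult_left_mono)
      show "measure lborel (U - A) \<le> e / (\<bar>c\<bar> + 1)"
        unfolding measure_def using U(3) \<open>e / (\<bar>c\<bar> + 1) > 0\<close>
        by (intro enn2real_leI) auto
    qed simp
    also have "\<dots> \<le> e" using \<open>e > 0\<close> by (simp add: field_simps)
    finally show "\<exists>w. integrable lborel w \<and> L1_translation_continuous w \<and>
                   (LINT x|lborel. \<bar>indicator A x *\<^sub>R c - w x\<bar>) \<le> e"
      using L1_translation_continuous_open[OF U(1) fin, of c] IU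
      by (intro exI[of _ "\<lambda>x. indicator U x * c"]) auto
  qed (use IA in auto)
next
  case (add f g)
  then show ?case by (simp add: L1_translation_continuous_add)
next
  case (lim f s)
  have *: "(\<lambda>i. LINT x|lborel. \<bar>f x - s i x\<bar>) \<longlonglongrightarrow> (LINT x::real|lborel. 0 :: real)"
  proof (rule integral_dominated_convergence[where f="\<lambda>_. 0" and s="\<lambda>i x. \<bar>f x - s i x\<bar>"
        and w="\<lambda>x. 3 * \<bar>f x\<bar>"])
    show "AE x in lborel. (\<lambda>i. \<bar>f x - s i x\<bar>) \<longlonglongrightarrow> 0"
    proof (rule AE_I2)
      fix x show "(\<lambda>i. \<bar>f x - s i x\<bar>) \<longlonglongrightarrow> 0"
        using tendsto_rabs_zero[of "\<lambda>i. f x - s i x"] tendsto_diff[OF tendsto_const lim(3), of x "f x"] by simp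
    qed
    show "AE x in lborel. norm \<bar>f x - s i x\<bar> \<le> 3 * \<bar>f x\<bar>" for i
    proof (rule AE_I2)
      fix x show "norm \<bar>f x - s i x\<bar> \<le> 3 * \<bar>f x\<bar>"
        using lim(4)[of x i] by (simp)
    qed
  qed (use lim in auto)
  show ?case
  proof (rule L1_translation_continuous_approx[OF lim(5)])
    fix e :: real assume "e > 0"
    with LIMSEQ_D[OF *, of e] obtain i where "\<bar>LINT x|lborel. \<bar>f x - s i x\<bar>\<bar> < e" by auto
    then show "\<exists>w. integrable lborel w \<and> L1_translation_continuous w \<and> (LINT x|lborel. \<bar>f x - w x\<bar>) \<le> e"
      using lim by (intro exI[of _ "s i"]) auto
  qed
qed

text \<open>This reduces mean-square continuity of \<open>w\<close> to mean continuity of the integrable function \<open>w\<bar>w\<bar>\<close>.\<close>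

lemma square_diff_le_signed_square:
  fixes a b :: real
  shows "(a - b)\<^sup>2 \<le> 2 * \<bar>a * \<bar>a\<bar> - b * \<bar>b\<bar>\<bar>"
proof -
  have *: "(a - b)\<^sup>2 \<le> 2 * \<bar>a * \<bar>a\<bar> - b * \<bar>b\<bar>\<bar>" if "a \<ge> b" for a b :: real
  proof -
    consider "b \<ge> 0" | "a \<le> 0" | "a \<ge> 0" "b \<le> 0" by linarith
    then show ?thesis
    proof cases
      case 1
      with that have "(a - b) * (a - b) \<le> (a - b) * (a + b)" by (intro mult_left_mono) auto
      moreover have "(a - b) * (a + b) \<ge> 0" using 1 that by auto
      ultimately show ?thesis using 1 that by (simp add: power2_eq_square algebra_simps)
    next
      case 2
      with that have "(a - b) * (a - b) \<le> (a - b) * (- a - b)" by (intro mult_left_mono) auto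
      moreover have "(a - b) * (-a - b) \<ge> 0" using 2 that by (intro mult_nonneg_nonneg) auto
      ultimately show ?thesis using 2 that by (simp add: power2_eq_square algebra_simps)
    next
      case 3
      have "(a + b) * (a + b) \<ge> 0" by simp
      then show ?thesis using 3 by (simp add: power2_eq_square algebra_simps)
    qed
  qed
  show ?thesis
    using *[of a b] *[of b a] by (cases "a \<ge> b") (auto simp: power2_commute abs_minus_commute)
qed

lemma L2_translation_continuous_real:
  fixes w :: "real \<Rightarrow> real"
  assumes [measurable]: "w \<in> borel_measurable borel"
    and "integrable lborel (\<lambda>x. (w x)\<^sup>2)" and s: "s \<longlonglongrightarrow> (0::real)"
  shows "(\<lambda>n::nat. LINT x|lborel. (w (x - s n) - w x)\<^sup>2) \<longlonglongrightarrow> 0"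
proof -
  have I: "integrable lborel (\<lambda>x. w x * \<bar>w x\<bar>)"
    by (rule Bochner_Integration.integrable_bound[OF assms(2)])
       (auto simp: abs_mult power2_eq_square)
  note [simp] = I integrable_translate[OF I]
  have lim: "(\<lambda>n. 2 * (LINT x|lborel. \<bar>w (x - s n) * \<bar>w (x - s n)\<bar> - w x * \<bar>w x\<bar>\<bar>)) \<longlonglongrightarrow> 0"
    using integrable_imp_L1_translation_continuous[OF I] s
    by (auto simp: L1_translation_continuous_def intro!: tendsto_mult_right_zero)
  show ?thesis
  proof (rule tendsto_sandwich[OF always_eventually always_eventually tendsto_const lim]; intro allI)
    fix n
    have "(LINT x|lborel. (w (x - s n) - w x)\<^sup>2) \<le> (LINT x|lborel. 2 * \<bar>w (x - s n) * \<bar>w (x - s n)\<bar> - w x * \<bar>w x\<bar>\<bar>)"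
    proof (rule integral_mono')
      show "integrable lborel (\<lambda>x. 2 * \<bar>w (x - s n) * \<bar>w (x - s n)\<bar> - w x * \<bar>w x\<bar>\<bar>)" by simp
    qed (auto simp: square_diff_le_signed_square)
    then show "(LINT x|lborel. (w (x - s n) - w x)\<^sup>2) \<le> 2 * (LINT x|lborel. \<bar>w (x - s n) * \<bar>w (x - s n)\<bar> - w x * \<bar>w x\<bar>\<bar>)"
      by simp
  qed simp
qed

lemma L2_translation_continuous:
  fixes u :: "real \<Rightarrow> complex"
  assumes [measurable]: "u \<in> borel_measurable borel"
    and "integrable lborel (\<lambda>x. (cmod (u x))\<^sup>2)" and s: "s \<longlonglongrightarrow> (0::real)"
  shows "(\<lambda>n::nat. LINT x|lborel. (cmod (u (x - s n) - u x))\<^sup>2) \<longlonglongrightarrow> 0"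
proof -
  have R: "integrable lborel (\<lambda>x. (Re (u x))\<^sup>2)"
    by (rule Bochner_Integration.integrable_bound[OF assms(2)]) (auto simp: cmod_power2)
  have I: "integrable lborel (\<lambda>x. (Im (u x))\<^sup>2)"
    by (rule Bochner_Integration.integrable_bound[OF assms(2)]) (auto simp: cmod_power2)
  have diff: "integrable lborel (\<lambda>x. (w (x - s) - w x)\<^sup>2)" 
    if [measurable]: "w \<in> borel_measurable borel" and i: "integrable lborel (\<lambda>x. (w x)\<^sup>2)" for w :: "real \<Rightarrow> real" and s
  proof (rule Bochner_Integration.integrable_bound)
    show "integrable lborel (\<lambda>x. 2 * (w (x - s))\<^sup>2 + 2 * (w x)\<^sup>2)"
      using i integrable_translate[OF i] by simp
    have "(a - b)\<^sup>2 \<le> 2 * a\<^sup>2 + 2 * b\<^sup>2" for a b :: real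
      using zero_le_power2[of "a + b"] by (simp add: power2_eq_square algebra_simps)
    then show "AE x in lborel. norm ((w (x - s) - w x)\<^sup>2) \<le> norm (2 * (w (x - s))\<^sup>2 + 2 * (w x)\<^sup>2)"
      by auto
  qed simp
  have "(\<lambda>n. (LINT x|lborel. (Re (u (x - s n)) - Re (u x))\<^sup>2) + (LINT x|lborel. (Im (u (x - s n)) - Im (u x))\<^sup>2)) \<longlonglongrightarrow> 0"
    using L2_translation_continuous_real[OF _ R s] L2_translation_continuous_real[OF _ I s]
    by (auto intro!: tendsto_add_zero)
  then show ?thesis
    using diff[OF _ R] diff[OF _ I] by (simp add: cmod_power2)
qed

section \<open>Plancherel's identity on the line\<close>

definition fourier :: "(real \<Rightarrow> complex) \<Rightarrow> real \<Rightarrow> complex" where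
  "fourier u r = (LINT x|lborel. cis (2 * pi * r * x) * u x)"

lemma borel_measurable_cis [measurable]:
  "f \<in> borel_measurable M \<Longrightarrow> (\<lambda>x. cis (f x)) \<in> borel_measurable M"
  by (rule measurable_compose[OF _ borel_measurable_continuous_onI]) (auto intro: continuous_on_cis)

lemma borel_measurable_cnj [measurable]:
  "f \<in> borel_measurable M \<Longrightarrow> (\<lambda>x. cnj (f x)) \<in> borel_measurable M"
  by (rule measurable_compose[OF _ borel_measurable_continuous_onI]) (auto intro: continuous_on_cnj)

lemma borel_measurable_fourier [measurable]:
  assumes [measurable]: "u \<in> borel_measurable borel"
  shows "fourier u \<in> borel_measurable borel"
proof -
  have "(\<lambda>r. LINT x|lborel. cis (2 * pi * r * x) * u x) \<in> borel_measurable lborel"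
    by measurable
  then show ?thesis by (simp add: fourier_def[abs_def])
qed

text \<open>The inequality of arithmetic and geometric means gives a cruder constant than Cauchy-Schwarz,
  but only the uniformity in \<open>s\<close> matters.\<close>

lemma integral_abs_autocorrelation_le:
  fixes u :: "real \<Rightarrow> complex"
  assumes u2: "integrable lborel (\<lambda>x. (cmod (u x))\<^sup>2)"
  shows "(LINT x|lborel. cmod (u x) * cmod (u (x - s))) \<le> 2 * (LINT x|lborel. (cmod (u x))\<^sup>2)"
proof -
  note [simp] = u2 integrable_translate[OF u2]
  have "(LINT x|lborel. cmod (u x) * cmod (u (x - s))) \<le> (LINT x|lborel. (cmod (u x))\<^sup>2 + (cmod (u (x - s)))\<^sup>2)"
  proof (rule integral_mono')
    fix x
    have "2 * (cmod (u x) * cmod (u (x - s))) \<le> (cmod (u x))\<^sup>2 + (cmod (u (x - s)))\<^sup>2"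
      using sum_squares_bound[of "cmod (u x)" "cmod (u (x - s))"] by (simp add: mult.assoc)
    moreover have "0 \<le> cmod (u x) * cmod (u (x - s))" by simp
    ultimately show "cmod (u x) * cmod (u (x - s)) \<le> (cmod (u x))\<^sup>2 + (cmod (u (x - s)))\<^sup>2"
      by linarith
  qed auto
  also have "\<dots> = 2 * (LINT x|lborel. (cmod (u x))\<^sup>2)"
    using integral_translate[of "\<lambda>x. (cmod (u x))\<^sup>2" s] by simp
  finally show ?thesis .
qed

text \<open>The polarization identity expresses the real part of the autocorrelation by the mean-square
  modulus of continuity, so that its continuity at \<open>s = 0\<close> follows from that of translations.\<close>

lemma integrable_autocorrelation:
  fixes u :: "real \<Rightarrow> complex"
  assumes [measurable]: "u \<in> borel_measurable borel" and u2: "integrable lborel (\<lambda>x. (cmod (u x))\<^sup>2)"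
  shows "integrable lborel (\<lambda>x. u x * cnj (u (x - s)))"
    and "integrable lborel (\<lambda>x. (cmod (u (x - s) - u x))\<^sup>2)"
    and "Re (LINT x|lborel. u x * cnj (u (x - s))) =
      (LINT x|lborel. (cmod (u x))\<^sup>2) - (LINT x|lborel. (cmod (u (x - s) - u x))\<^sup>2) / 2"
    and "(LINT x|lborel. (cmod (u (x - s) - u x))\<^sup>2) \<le> 4 * (LINT x|lborel. (cmod (u x))\<^sup>2)"
proof -
  note [simp] = u2 integrable_translate[OF u2]
  have ineq: "cmod (a * cnj b) \<le> (cmod a)\<^sup>2 + (cmod b)\<^sup>2" for a b
  proof -
    have "2 * (cmod a * cmod b) \<le> (cmod a)\<^sup>2 + (cmod b)\<^sup>2"
      using sum_squares_bound[of "cmod a" "cmod b"] by (simp add: mult.assoc)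
    moreover have "cmod a * cmod b \<ge> 0" by simp
    ultimately show ?thesis unfolding norm_mult complex_mod_cnj by linarith
  qed
  show I1: "integrable lborel (\<lambda>x. u x * cnj (u (x - s)))"
    by (rule Bochner_Integration.integrable_bound[of _ "\<lambda>x. (cmod (u x))\<^sup>2 + (cmod (u (x - s)))\<^sup>2"])
       (use ineq in \<open>auto intro!: AE_I2\<close>)
  define c where "c x = Re (u x * cnj (u (x - s)))" for x
  have c: "integrable lborel c" "integral\<^sup>L lborel c = Re (LINT x|lborel. u x * cnj (u (x - s)))"
    unfolding c_def[abs_def] by (rule integrable_Re[OF I1], rule integral_Re[OF I1])
  have expand: "(cmod (u (x - s) - u x))\<^sup>2 = (cmod (u x))\<^sup>2 + (cmod (u (x - s)))\<^sup>2 - 2 * c x" for x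
    by (simp add: cmod_power2 c_def) (simp add: power2_eq_square algebra_simps)
  show I2: "integrable lborel (\<lambda>x. (cmod (u (x - s) - u x))\<^sup>2)"
    unfolding expand using c by (intro Bochner_Integration.integrable_diff) auto
  have tr: "(LINT x|lborel. (cmod (u (x - s)))\<^sup>2) = (LINT x|lborel. (cmod (u x))\<^sup>2)"
    using integral_translate[of "\<lambda>x. (cmod (u x))\<^sup>2"] .
  have "(LINT x|lborel. (cmod (u (x - s) - u x))\<^sup>2) = 2 * (LINT x|lborel. (cmod (u x))\<^sup>2)
     - 2 * integral\<^sup>L lborel c"
    unfolding expand using c(1) tr by simp
  then show "Re (LINT x|lborel. u x * cnj (u (x - s))) =
      (LINT x|lborel. (cmod (u x))\<^sup>2) - (LINT x|lborel. (cmod (u (x - s) - u x))\<^sup>2) / 2"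
    using c by (simp add: field_simps)
  have par: "(cmod (a - b))\<^sup>2 \<le> 2 * (cmod a)\<^sup>2 + 2 * (cmod b)\<^sup>2" for a b
  proof -
    have "(cmod (a - b))\<^sup>2 \<le> (cmod a + cmod b)\<^sup>2"
      by (intro power_mono norm_triangle_ineq4) simp
    also have "\<dots> \<le> 2 * (cmod a)\<^sup>2 + 2 * (cmod b)\<^sup>2"
      using zero_le_power2[of "cmod a - cmod b"] by (simp add: power2_eq_square algebra_simps)
    finally show ?thesis .
  qed
  have "(LINT x|lborel. (cmod (u (x - s) - u x))\<^sup>2) \<le> (LINT x|lborel. 2 * (cmod (u (x - s)))\<^sup>2 + 2 * (cmod (u x))\<^sup>2)"
    using I2 par by (intro integral_mono) auto
  then show "(LINT x|lborel. (cmod (u (x - s) - u x))\<^sup>2) \<le> 4 * (LINT x|lborel. (cmod (u x))\<^sup>2)"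
    using tr by simp
qed

text \<open>gauss avg\<close>

lemma integral_std_normal_distribution:
  fixes f :: "real \<Rightarrow> 'a::{banach, second_countable_topology}"
  assumes [measurable]: "f \<in> borel_measurable borel"
  shows "integral\<^sup>L std_normal_distribution f = (LINT z|lborel. std_normal_density z *\<^sub>R f z)"
  by (subst integral_density) auto

lemma integral_cis_std_normal:
  "(LINT z|std_normal_distribution. cis (t * z)) = complex_of_real (exp (- (t\<^sup>2) / 2))"
  using fun_cong[OF char_std_normal_distribution, of t]
  by (simp add: char_def cis_conv_exp)

text \<open>The Gaussian weight makes the triple integral absolutely convergent. By Fubini, the square of the
  transform turns into \<open>\<integral>\<integral> u(x) cnj(u(y)) \<dots>\<close> with the characteristic function of the normal law at
  \<open>2\<pi>n(x - y)\<close> as kernel. This kernel is again a Gaussian, now of width \<open>1/(2\<pi>n)\<close>, so the right-hand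
  side averages the autocorrelation near \<open>0\<close>.\<close>

lemma gaussian_mean_fourier:
  fixes u :: "real \<Rightarrow> complex"
  assumes u1: "integrable lborel u" and u2: "integrable lborel (\<lambda>x. (cmod (u x))\<^sup>2)" and n: "n > 0"
  shows "complex_of_real (LINT z|std_normal_distribution. (cmod (fourier u (n * z)))\<^sup>2) =
     (1 / (n * sqrt (2 * pi))) * (LINT z|std_normal_distribution. LINT x|lborel. u x * cnj (u (x - z / (2 * pi * n))))"
proof -
  let ?N = std_normal_distribution
  have [measurable]: "u \<in> borel_measurable borel" using u1 by auto
  interpret N: prob_space ?N using prob_space_normal_density by simp
  interpret NL: pair_sigma_finite ?N lborel ..
  interpret NLL: pair_sigma_finite ?N "lborel \<Otimes>\<^sub>M lborel :: (real \<times> real) measure" ..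
  have uu: "integrable (lborel \<Otimes>\<^sub>M lborel) (\<lambda>(x,y). u x * cnj (u y))"
  proof (rule lborel_pair.Fubini_integrable)
    show "(\<lambda>(x, y). u x * cnj (u y)) \<in> borel_measurable (lborel \<Otimes>\<^sub>M lborel)" by measurable
  qed (use u1 in \<open>auto simp: norm_mult\<close>)
  define F where "F = (\<lambda>z (x, y). cis (2 * pi * n * (x - y) * z) * (u x * cnj (u y)))"
  have F_meas [measurable]: "(\<lambda>(z, p). F z p) \<in> borel_measurable (?N \<Otimes>\<^sub>M (lborel \<Otimes>\<^sub>M lborel))"
    unfolding F_def by (simp add: split_beta') measurable
  have F_norm: "norm (F z p) = norm (case p of (x, y) \<Rightarrow> u x * cnj (u y))" for z p
    by (cases p) (simp add: F_def norm_mult)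
  have F_z: "integrable (lborel \<Otimes>\<^sub>M lborel) (F z)" for z
  proof (rule Bochner_Integration.integrable_bound[OF uu])
    show "F z \<in> borel_measurable (lborel \<Otimes>\<^sub>M lborel)"
      unfolding F_def by (simp add: split_beta') 
  qed (auto simp only: F_norm intro!: AE_I2)
  have F_int: "integrable (?N \<Otimes>\<^sub>M (lborel \<Otimes>\<^sub>M lborel)) (\<lambda>(z, p). F z p)"
    by (rule NLL.Fubini_integrable) (use F_z in \<open>simp_all add: F_norm\<close>)
  have sq: "complex_of_real ((cmod (fourier u (n * z)))\<^sup>2) = (LINT p|(lborel \<Otimes>\<^sub>M lborel). F z p)" for z
  proof -
    have "complex_of_real ((cmod (fourier u (n * z)))\<^sup>2) = fourier u (n * z) * cnj (fourier u (n * z))"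
      by (simp only: complex_norm_square)
    also have "cnj (fourier u (n * z)) = (LINT y|lborel. cis (- (2 * pi * (n * z) * y)) * cnj (u y))"
    proof -
      have "cnj (fourier u (n * z)) = (LINT y|lborel. cnj (cis (2 * pi * (n * z) * y) * u y))"
        unfolding fourier_def by (rule Bochner_Integration.integral_cnj[symmetric])
      then show ?thesis unfolding complex_cnj_mult cis_cnj .
    qed
    also have "fourier u (n * z) * \<dots> = (LINT x|lborel. LINT y|lborel. (cis (2 * pi * (n * z) * x) * u x) * (cis (- (2 * pi * (n * z) * y)) * cnj (u y)))"
      unfolding fourier_def by simp
    also have "\<dots> = (LINT x|lborel. LINT y|lborel. F z (x, y))"
    proof (intro Bochner_Integration.integral_cong refl)
      fix x y
      have "cis (2 * pi * n * (x - y) * z) = cis (2 * pi * (n * z) * x) * cis (- (2 * pi * (n * z) * y))"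
        unfolding cis_mult by (rule arg_cong[of _ _ cis]) (simp add: algebra_simps)
      then show "(cis (2 * pi * (n * z) * x) * u x) * (cis (- (2 * pi * (n * z) * y)) * cnj (u y)) = F z (x, y)"
        by (simp add: F_def)
    qed
    also have "\<dots> = (LINT p|(lborel \<Otimes>\<^sub>M lborel). F z p)"
      by (rule lborel_pair.integral_fst'[OF F_z])
    finally show ?thesis .
  qed
  have "complex_of_real (LINT z|?N. (cmod (fourier u (n * z)))\<^sup>2) = (LINT z|?N. LINT p|(lborel \<Otimes>\<^sub>M lborel). F z p)"
    unfolding sq[symmetric] by (rule integral_complex_of_real[symmetric])
  also have "\<dots> = (LINT p|(lborel \<Otimes>\<^sub>M lborel). LINT z|?N. F z p)"
    by (rule NLL.Fubini_integral[OF F_int, symmetric])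
  also have "\<dots> = (LINT p|(lborel \<Otimes>\<^sub>M lborel). (case p of (x, y) \<Rightarrow> exp (- ((2 * pi * n * (x - y))\<^sup>2) / 2) * (u x * cnj (u y))))"
  proof (intro Bochner_Integration.integral_cong refl)
    fix p :: "real \<times> real"
    obtain x y where p: "p = (x, y)" by (cases p)
    show "(LINT z|?N. F z p) = (case p of (x, y) \<Rightarrow> exp (- ((2 * pi * n * (x - y))\<^sup>2) / 2) * (u x * cnj (u y)))"
      unfolding p F_def prod.case integral_mult_left_zero integral_cis_std_normal ..
  qed
  also have "\<dots> = (LINT x|lborel. LINT y|lborel. exp (- ((2 * pi * n * (x - y))\<^sup>2) / 2) * (u x * cnj (u y)))"
  proof (subst lborel_pair.integral_fst'[symmetric])
    show "integrable (lborel \<Otimes>\<^sub>M lborel) (\<lambda>(x, y). complex_of_real (exp (- ((2 * pi * n * (x - y))\<^sup>2) / 2)) * (u x * cnj (u y)))"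
      by (rule Bochner_Integration.integrable_bound[OF uu])
         (auto simp: norm_mult split_beta' intro!: AE_I2 mult_left_le_one_le)
  qed simp
  \<comment> \<open>Substitute \<open>y = x - z / (2\<pi>n)\<close>, which turns the kernel into the standard Gaussian.\<close>
  also have "\<dots> = (LINT x|lborel. (1 / (2 * pi * n)) * (LINT z|lborel. complex_of_real (exp (- (z\<^sup>2) / 2)) * (u x * cnj (u (x - z / (2 * pi * n))))))"
  proof (intro Bochner_Integration.integral_cong refl)
    fix x
    have "(LINT y|lborel. exp (- ((2 * pi * n * (x - y))\<^sup>2) / 2) * (u x * cnj (u y)))
      = \<bar>- 1 / (2 * pi * n)\<bar> *\<^sub>R (LINT z|lborel. exp (- ((2 * pi * n * (x - (x + (-1 / (2 * pi * n)) * z)))\<^sup>2) / 2) * (u x * cnj (u (x + (-1 / (2 * pi * n)) * z))))"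
      using n by (intro lborel_integral_real_affine) simp
    then show "(LINT y|lborel. exp (- ((2 * pi * n * (x - y))\<^sup>2) / 2) * (u x * cnj (u y)))
      = (1 / (2 * pi * n)) * (LINT z|lborel. complex_of_real (exp (- (z\<^sup>2) / 2)) * (u x * cnj (u (x - z / (2 * pi * n)))))"
      using n by (simp add: scaleR_conv_of_real)
  qed
  also have "\<dots> = (LINT x|lborel. (1 / (n * sqrt (2 * pi))) * (LINT z|?N. u x * cnj (u (x - z / (2 * pi * n)))))"
  proof (intro Bochner_Integration.integral_cong refl)
    fix x
    have "(LINT z|?N. u x * cnj (u (x - z / (2 * pi * n)))) = 
       (LINT z|lborel. (1 / sqrt (2 * pi)) *\<^sub>R (complex_of_real (exp (- (z\<^sup>2) / 2)) * (u x * cnj (u (x - z / (2 * pi * n))))))"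
      by (subst integral_std_normal_distribution) (auto simp: std_normal_density_def scaleR_conv_of_real mult_ac)
    also have "\<dots> = (1 / sqrt (2 * pi)) *\<^sub>R (LINT z|lborel. (complex_of_real (exp (- (z\<^sup>2) / 2)) * (u x * cnj (u (x - z / (2 * pi * n))))))"
      by (rule integral_scaleR_right)
    finally have e: "(LINT z|?N. u x * cnj (u (x - z / (2 * pi * n)))) = 
       (1 / sqrt (2 * pi)) *\<^sub>R (LINT z|lborel. (complex_of_real (exp (- (z\<^sup>2) / 2)) * (u x * cnj (u (x - z / (2 * pi * n))))))" .
    have c: "1 / (2 * pi * n) = (1 / (n * sqrt (2 * pi))) * (1 / sqrt (2 * pi))"
      by (simp add: field_simps)
    show "(1 / (2 * pi * n)) * (LINT z|lborel. complex_of_real (exp (- (z\<^sup>2) / 2)) * (u x * cnj (u (x - z / (2 * pi * n))))) =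
       complex_of_real (1 / (n * sqrt (2 * pi))) * (LINT z|?N. u x * cnj (u (x - z / (2 * pi * n))))"
      unfolding e c by (simp add: scaleR_conv_of_real)
  qed
  also have "\<dots> = (1 / (n * sqrt (2 * pi))) * (LINT x|lborel. LINT z|?N. u x * cnj (u (x - z / (2 * pi * n))))"
    by simp
  also have "(LINT x|lborel. LINT z|?N. u x * cnj (u (x - z / (2 * pi * n)))) =
     (LINT z|?N. LINT x|lborel. u x * cnj (u (x - z / (2 * pi * n))))"
  proof (rule NL.Fubini_integral)
    show "integrable (?N \<Otimes>\<^sub>M lborel) (\<lambda>(z, x). u x * cnj (u (x - z / (2 * pi * n))))"
    proof (rule NL.Fubini_integrable)
      show "(\<lambda>(z, x). u x * cnj (u (x - z / (2 * pi * n)))) \<in> borel_measurable (?N \<Otimes>\<^sub>M lborel)"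
        by measurable
      show "AE z in ?N. integrable lborel (\<lambda>y. case (z, y) of (z, x) \<Rightarrow> u x * cnj (u (x - z / (2 * pi * n))))"
        using integrable_autocorrelation(1)[OF _ u2] by simp
      show "integrable ?N (\<lambda>z. LINT y|lborel. norm (case (z, y) of (z, x) \<Rightarrow> u x * cnj (u (x - z / (2 * pi * n)))))"
        using integral_abs_autocorrelation_le[OF u2] by (intro N.integrable_const_bound[where B="2 * (LINT x|lborel. (cmod (u x))\<^sup>2)"])
          (auto simp: norm_mult)
    qed
  qed
  finally show ?thesis .
qed

text \<open>Dominated convergence with respect to the normal law, since the autocorrelation is bounded and
  its real part is continuous at \<open>0\<close>.\<close>

lemma gaussian_mean_autocorrelation_tendsto:
  fixes u :: "real \<Rightarrow> complex"
  assumes [measurable]: "u \<in> borel_measurable borel" and u2: "integrable lborel (\<lambda>x. (cmod (u x))\<^sup>2)"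
    and s: "s \<longlonglongrightarrow> (0::real)"
  shows "(\<lambda>n::nat. LINT z|std_normal_distribution. Re (LINT x|lborel. u x * cnj (u (x - z * s n))))
     \<longlonglongrightarrow> (LINT x|lborel. (cmod (u x))\<^sup>2)"
proof -
  let ?N = std_normal_distribution
  interpret N: prob_space ?N using prob_space_normal_density by simp
  define \<omega> where "\<omega> s = (LINT x|lborel. (cmod (u (x - s) - u x))\<^sup>2)" for s
  have [measurable]: "\<omega> \<in> borel_measurable borel"
  proof -
    have "(\<lambda>s. LINT x|lborel. (cmod (u (x - s) - u x))\<^sup>2) \<in> borel_measurable lborel" by measurable
    then show ?thesis by (simp add: \<omega>_def[abs_def])
  qed
  have "(\<lambda>n. LINT z|?N. (LINT x|lborel. (cmod (u x))\<^sup>2) - \<omega> (z * s n) / 2) \<longlonglongrightarrow> (LINT z|?N. (LINT x|lborel. (cmod (u x))\<^sup>2))"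
  proof (rule integral_dominated_convergence[where w="\<lambda>_. 3 * (LINT x|lborel. (cmod (u x))\<^sup>2)"])
    show "AE z in ?N. (\<lambda>n. (LINT x|lborel. (cmod (u x))\<^sup>2) - \<omega> (z * s n) / 2) \<longlonglongrightarrow> (LINT x|lborel. (cmod (u x))\<^sup>2)"
    proof (rule AE_I2)
      fix z
      have "(\<lambda>n. z * s n) \<longlonglongrightarrow> 0" using tendsto_mult[OF tendsto_const s, of z] by simp
      from L2_translation_continuous[OF assms(1,2) this]
      have "(\<lambda>n. \<omega> (z * s n)) \<longlonglongrightarrow> 0" by (simp add: \<omega>_def)
      then show "(\<lambda>n. (LINT x|lborel. (cmod (u x))\<^sup>2) - \<omega> (z * s n) / 2) \<longlonglongrightarrow> (LINT x|lborel. (cmod (u x))\<^sup>2)"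
        by (auto intro!: tendsto_eq_intros)
    qed
    show "AE z in ?N. norm ((LINT x|lborel. (cmod (u x))\<^sup>2) - \<omega> (z * s n) / 2) \<le> 3 * (LINT x|lborel. (cmod (u x))\<^sup>2)" for n
    proof (rule AE_I2)
      fix z
      have "0 \<le> \<omega> (z * s n)" "\<omega> (z * s n) \<le> 4 * (LINT x|lborel. (cmod (u x))\<^sup>2)"
        using integrable_autocorrelation(4)[OF assms(1,2)] by (auto simp: \<omega>_def)
      then show "norm ((LINT x|lborel. (cmod (u x))\<^sup>2) - \<omega> (z * s n) / 2) \<le> 3 * (LINT x|lborel. (cmod (u x))\<^sup>2)"
        by simp
    qed
  qed auto
  then show ?thesis
    using N.prob_space by (simp add: integrable_autocorrelation(3)[OF assms(1,2)] \<omega>_def)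
qed

text \<open>Removing the Gaussian weight: its dilates increase to \<open>1\<close>, so the weighted integrals of
  \<open>\<bar>fourier u\<bar>\<^sup>2\<close> increase to the full one; on the other side they are Gaussian means of the
  autocorrelation, which tend to its value at \<open>0\<close>, the squared norm of \<open>u\<close>.\<close>

lemma plancherel:
  fixes u :: "real \<Rightarrow> complex"
  assumes u1: "integrable lborel u" and u2: "integrable lborel (\<lambda>x. (cmod (u x))\<^sup>2)"
  shows "(\<integral>\<^sup>+r. ennreal ((cmod (fourier u r))\<^sup>2) \<partial>lborel) = (\<integral>\<^sup>+x. ennreal ((cmod (u x))\<^sup>2) \<partial>lborel)"
proof -
  let ?N = std_normal_distribution
  interpret N: prob_space ?N using prob_space_normal_density by simp
  have [measurable]: "u \<in> borel_measurable borel" using u1 by auto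
  have bound: "cmod (fourier u r) \<le> (LINT x|lborel. cmod (u x))" for r
    unfolding fourier_def by (rule integral_norm_bound[THEN order_trans]) (simp add: norm_mult)
  have sq: "(cmod (fourier u r))\<^sup>2 \<le> (LINT x|lborel. cmod (u x))\<^sup>2" for r
    using bound by (intro power_mono) auto
  define E where "E n = (\<integral>\<^sup>+r. ennreal (exp (- ((r / real (Suc n))\<^sup>2) / 2)) * ennreal ((cmod (fourier u r))\<^sup>2) \<partial>lborel)" for n
  define a where "a n = (LINT z|?N. Re (LINT x|lborel. u x * cnj (u (x - z * (1 / (2 * pi * real (Suc n)))))))" for n
  have E: "E n = ennreal (a n)" for n
  proof -
    let ?n = "real (Suc n)"
    have [simp]: "?n > 0" by simp
    have int: "integrable ?N (\<lambda>z. (cmod (fourier u (?n * z)))\<^sup>2)"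
      using sq by (intro N.integrable_const_bound[where B="(LINT x|lborel. cmod (u x))\<^sup>2"]) auto
    have "E n = ?n * (\<integral>\<^sup>+z. ennreal (exp (- (z\<^sup>2) / 2)) * ennreal ((cmod (fourier u (?n * z)))\<^sup>2) \<partial>lborel)"
      unfolding E_def by (subst nn_integral_real_affine[where c="?n" and t=0]) auto
    also have "\<dots> = ?n * (\<integral>\<^sup>+z. ennreal (sqrt (2 * pi)) * (ennreal (std_normal_density z) * ennreal ((cmod (fourier u (?n * z)))\<^sup>2)) \<partial>lborel)"
    proof (rule arg_cong[OF nn_integral_cong])
      fix z :: real
      have "exp (- (z\<^sup>2) / 2) = sqrt (2 * pi) * std_normal_density z"
        by (simp add: std_normal_density_def)
      then show "ennreal (exp (- (z\<^sup>2) / 2)) * ennreal ((cmod (fourier u (?n * z)))\<^sup>2)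
         = ennreal (sqrt (2 * pi)) * (ennreal (std_normal_density z) * ennreal ((cmod (fourier u (?n * z)))\<^sup>2))"
        by (simp add: ennreal_mult[symmetric] mult.assoc del: of_nat_Suc)
    qed
    also have "\<dots> = ennreal (?n * sqrt (2 * pi)) * (\<integral>\<^sup>+z. ennreal ((cmod (fourier u (?n * z)))\<^sup>2) \<partial>?N)"
      by (subst nn_integral_cmult) (auto simp: nn_integral_density ennreal_mult mult.assoc)
    also have "(\<integral>\<^sup>+z. ennreal ((cmod (fourier u (?n * z)))\<^sup>2) \<partial>?N) = ennreal (LINT z|?N. (cmod (fourier u (?n * z)))\<^sup>2)"
      using int by (rule nn_integral_eq_integral) simp
    also have "ennreal (?n * sqrt (2 * pi)) * \<dots> = ennreal (?n * sqrt (2 * pi) * (LINT z|?N. (cmod (fourier u (?n * z)))\<^sup>2))"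
      by (simp add: ennreal_mult)
    also have "?n * sqrt (2 * pi) * (LINT z|?N. (cmod (fourier u (?n * z)))\<^sup>2) = a n"
    proof -
      have m: "(\<lambda>z. LINT x|lborel. u x * cnj (u (x - z / (2 * pi * ?n)))) \<in> borel_measurable ?N"
        by measurable
      have "integrable ?N (\<lambda>z. LINT x|lborel. u x * cnj (u (x - z / (2 * pi * ?n))))"
      proof (rule N.integrable_const_bound[where B="2 * (LINT x|lborel. (cmod (u x))\<^sup>2)", OF AE_I2 m])
        fix z
        let ?s = "z / (2 * pi * ?n)"
        have "norm (LINT x|lborel. u x * cnj (u (x - ?s))) \<le> (LINT x|lborel. cmod (u x) * cmod (u (x - ?s)))"
          by (rule integral_norm_bound[THEN order_trans]) (simp add: norm_mult)
        also have "\<dots> \<le> 2 * (LINT x|lborel. (cmod (u x))\<^sup>2)"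
          by (rule integral_abs_autocorrelation_le[OF u2])
        finally show "norm (LINT x|lborel. u x * cnj (u (x - ?s))) \<le> 2 * (LINT x|lborel. (cmod (u x))\<^sup>2)" .
      qed
      from integral_Re[OF this]
      have "Re (LINT z|?N. LINT x|lborel. u x * cnj (u (x - z / (2 * pi * ?n)))) = a n"
        unfolding a_def times_divide_eq_right mult_1_right by (rule sym)
      moreover have "(LINT z|?N. LINT x|lborel. u x * cnj (u (x - z / (2 * pi * ?n)))) =
         complex_of_real (?n * sqrt (2 * pi) * (LINT z|?N. (cmod (fourier u (?n * z)))\<^sup>2))"
        unfolding of_real_mult[of "?n * sqrt (2 * pi)"] gaussian_mean_fourier[OF u1 u2 \<open>?n > 0\<close>]
        by (simp del: of_nat_Suc)
      ultimately show ?thesis by simp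
    qed
    finally show ?thesis .
  qed
  have "E \<longlonglongrightarrow> ennreal (LINT x|lborel. (cmod (u x))\<^sup>2)"
    unfolding E a_def
    by (intro tendsto_ennrealI gaussian_mean_autocorrelation_tendsto u2) (real_asymp | simp)+
  moreover have "E \<longlonglongrightarrow> (\<integral>\<^sup>+r. ennreal ((cmod (fourier u r))\<^sup>2) \<partial>lborel)"
    unfolding E_def
  proof (rule nn_integral_LIMSEQ)
    show "incseq (\<lambda>n r. ennreal (exp (- ((r / real (Suc n))\<^sup>2) / 2)) * ennreal ((cmod (fourier u r))\<^sup>2))"
    proof (intro incseq_SucI le_funI mult_right_mono ennreal_leI)
      fix n r
      have "\<bar>r / real (Suc (Suc n))\<bar> \<le> \<bar>r / real (Suc n)\<bar>"
        by (simp add: abs_divide frac_le)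
      then have "(r / real (Suc (Suc n)))\<^sup>2 \<le> (r / real (Suc n))\<^sup>2"
        by (rule power2_mono)
      then show "exp (- ((r / real (Suc n))\<^sup>2) / 2) \<le> exp (- ((r / real (Suc (Suc n)))\<^sup>2) / 2)" by simp
    qed simp
    fix r
    have "(\<lambda>n. exp (- ((r / real (Suc n))\<^sup>2) / 2)) \<longlonglongrightarrow> exp (- (0\<^sup>2) / 2)"
      by (intro tendsto_intros) (real_asymp | simp)+
    then have "(\<lambda>n. exp (- ((r / real (Suc n))\<^sup>2) / 2)) \<longlonglongrightarrow> 1" by simp
    then have "(\<lambda>n. ennreal (exp (- ((r / real (Suc n))\<^sup>2) / 2) * (cmod (fourier u r))\<^sup>2)) \<longlonglongrightarrow> ennreal (1 * (cmod (fourier u r))\<^sup>2)"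
      by (intro tendsto_ennrealI tendsto_mult tendsto_const)
    then show "(\<lambda>n. ennreal (exp (- ((r / real (Suc n))\<^sup>2) / 2)) * ennreal ((cmod (fourier u r))\<^sup>2)) \<longlonglongrightarrow> ennreal ((cmod (fourier u r))\<^sup>2)"
      by (simp add: ennreal_mult)
  qed auto
  ultimately have "(\<integral>\<^sup>+r. ennreal ((cmod (fourier u r))\<^sup>2) \<partial>lborel) = ennreal (LINT x|lborel. (cmod (u x))\<^sup>2)"
    by (metis LIMSEQ_unique)
  also have "\<dots> = (\<integral>\<^sup>+x. ennreal ((cmod (u x))\<^sup>2) \<partial>lborel)"
    using u2 by (simp add: nn_integral_eq_integral)
  finally show ?thesis .
qed

section \<open>Averages of lattice sums over long intervals\<close>

abbreviation interval_avg :: "real \<Rightarrow> real measure" where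
  "interval_avg R \<equiv> uniform_measure lborel {0..<R}"

text \<open>A constant of its own rather than an abbreviation: measurability of such a sum in a parameter is
  then decided term by term, and the exchange rule \<open>nn_integral_int_sum\<close> stays a terminating
  rewrite rule, since it does not apply to two nested sums.\<close>

definition int_sum :: "(int \<Rightarrow> ennreal) \<Rightarrow> ennreal" (binder "\<Sum>\<^sub>\<int>" [69] 69) where
  "int_sum f = nn_integral (count_space UNIV) f"

lemma int_sum_mono: "(\<And>n. f n \<le> g n) \<Longrightarrow> int_sum f \<le> int_sum g"
  unfolding int_sum_def by (rule nn_integral_mono)

lemma int_sum_cmult: "(\<Sum>\<^sub>\<int> n. c * f n) = c * int_sum f"
  unfolding int_sum_def by (rule nn_integral_cmult) simp

lemma nn_integral_int_sum:
  assumes "\<And>n. (\<lambda>x. f x n) \<in> borel_measurable M"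
  shows "(\<integral>\<^sup>+x. (\<Sum>\<^sub>\<int> n. f x n) \<partial>M) = (\<Sum>\<^sub>\<int> n. \<integral>\<^sup>+x. f x n \<partial>M)"
  unfolding int_sum_def
  by (rule nn_integral_count_space_nn_integral[where f="\<lambda>n x. f x n"]) (use assms in auto)

lemma borel_measurable_int_sum [measurable (raw)]:
  assumes [measurable]: "\<And>n. (\<lambda>x. f x n) \<in> borel_measurable M"
  shows "(\<lambda>x. \<Sum>\<^sub>\<int> n. f x n) \<in> borel_measurable M"
proof -
  have "bij_betw (from_nat_into UNIV :: nat \<Rightarrow> int) UNIV UNIV"
    by (rule bij_betw_from_nat_into) auto
  then have "(\<Sum>\<^sub>\<int> n. f x n) = (\<Sum>i. f x (from_nat_into UNIV i))" for x
    unfolding int_sum_def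
    by (subst nn_integral_bij_count_space[symmetric]) (auto simp: nn_integral_count_space_nat)
  then show ?thesis by simp
qed

lemma prob_space_interval_avg: "R > 0 \<Longrightarrow> prob_space (interval_avg R)"
  by (intro prob_space_uniform_measure) auto

text \<open>The integers \<open>n\<close> with \<open>0 \<le> y + cn < R\<close> fill an interval of length \<open>R/c\<close>, which contains between
  \<open>R/c - 1\<close> and \<open>R/c + 1\<close> of them wherever it lies.\<close>

lemma lattice_count_bounds:
  fixes c R y :: real
  assumes c: "c > 0" and R: "R > 0"
  shows "ennreal (R / c - 1) \<le> (\<Sum>\<^sub>\<int> n. indicator {0..<R} (y + c * of_int n))"
    and "(\<Sum>\<^sub>\<int> n. indicator {0..<R} (y + c * of_int n)) \<le> ennreal (R / c + 1)"
proof -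
  define a where "a = \<lceil>- y / c\<rceil>"
  define b where "b = \<lceil>(R - y) / c\<rceil>"
  have mem: "y + c * of_int n \<in> {0..<R} \<longleftrightarrow> n \<in> {a..<b}" for n
    using c by (auto simp: a_def b_def ceiling_le_iff less_ceiling_iff field_simps)
  have "(\<Sum>\<^sub>\<int> n. indicator {0..<R} (y + c * of_int n)) = (\<Sum>\<^sub>\<int> n. indicator {a..<b} n)"
    unfolding indicator_def mem ..
  also have "\<dots> = ennreal (real (nat (b - a)))"
    by (simp add: int_sum_def ennreal_of_nat_eq_real_of_nat)
  finally have eq: "(\<Sum>\<^sub>\<int> n. indicator {0..<R} (y + c * of_int n)) = ennreal (real (nat (b - a)))" .
  have ba: "real_of_int b < (R - y) / c + 1" "real_of_int b \<ge> (R - y) / c"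
      "real_of_int a < - y / c + 1" "real_of_int a \<ge> - y / c"
    unfolding a_def b_def by linarith+
  have *: "(R - y) / c = R / c + - y / c" using c by (simp add: field_simps)
  have "R / c > 0" using c R by simp
  show "ennreal (R / c - 1) \<le> (\<Sum>\<^sub>\<int> n. indicator {0..<R} (y + c * of_int n))"
    unfolding eq using ba * by (intro ennreal_leI) linarith
  show "(\<Sum>\<^sub>\<int> n. indicator {0..<R} (y + c * of_int n)) \<le> ennreal (R / c + 1)"
    unfolding eq using ba * \<open>R / c > 0\<close> by (intro ennreal_leI) linarith
qed

lemma nn_integral_translate:
  fixes \<phi> :: "real \<Rightarrow> ennreal"
  assumes [measurable]: "\<phi> \<in> borel_measurable borel"
  shows "(\<integral>\<^sup>+r. \<phi> (r - s) \<partial>lborel) = (\<integral>\<^sup>+r. \<phi> r \<partial>lborel)"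
  using nn_integral_real_affine[of \<phi> 1 "-s"] by simp

lemma nn_integral_interval_avg:
  assumes [measurable]: "\<phi> \<in> borel_measurable borel" and "R > 0"
  shows "(\<integral>\<^sup>+r. \<phi> r \<partial>interval_avg R) = ennreal (1 / R) * (\<integral>\<^sup>+r. \<phi> r * indicator {0..<R} r \<partial>lborel)"
proof -
  have "(\<integral>\<^sup>+r. \<phi> r \<partial>interval_avg R) = (\<integral>\<^sup>+r. \<phi> r * indicator {0..<R} r \<partial>lborel) / ennreal R"
    using assms(2) by (subst nn_integral_uniform_measure) auto
  also have "\<dots> = ennreal (1 / R) * (\<integral>\<^sup>+r. \<phi> r * indicator {0..<R} r \<partial>lborel)"
    using assms(2) by (simp add: divide_ennreal_def inverse_ennreal mult.commute inverse_eq_divide)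
  finally show ?thesis .
qed

text \<open>Unfolding: translating each summand to the origin collects the translates of \<open>[0, R)\<close> into the
  number of lattice points that they contain.\<close>

lemma interval_avg_periodization:
  assumes [measurable]: "\<phi> \<in> borel_measurable borel" and R: "R > 0" 
  shows "(\<integral>\<^sup>+r. (\<Sum>\<^sub>\<int> n. \<phi> (r - c * of_int n)) \<partial>interval_avg R) =
    ennreal (1 / R) * (\<integral>\<^sup>+y. \<phi> y * (\<Sum>\<^sub>\<int> n. indicator {0..<R} (y + c * of_int n)) \<partial>lborel)"
proof -
  have "(\<integral>\<^sup>+r. (\<Sum>\<^sub>\<int> n. \<phi> (r - c * of_int n)) \<partial>interval_avg R) = (\<Sum>\<^sub>\<int> n. \<integral>\<^sup>+r. \<phi> (r - c * of_int n) \<partial>interval_avg R)"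
    by (rule nn_integral_int_sum) auto
  also have "\<dots> = (\<Sum>\<^sub>\<int> n. ennreal (1 / R) * (\<integral>\<^sup>+y. \<phi> y * indicator {0..<R} (y + c * of_int n) \<partial>lborel))"
  proof (rule arg_cong[of _ _ int_sum], rule ext)
    fix n :: int
    have "(\<integral>\<^sup>+r. \<phi> (r - c * of_int n) * indicator {0..<R} r \<partial>lborel) = (\<integral>\<^sup>+y. \<phi> y * indicator {0..<R} (y + c * of_int n) \<partial>lborel)"
      using nn_integral_translate[of "\<lambda>y. \<phi> y * indicator {0..<R} (y + c * of_int n)" "c * of_int n"] by simp
    then show "(\<integral>\<^sup>+r. \<phi> (r - c * of_int n) \<partial>interval_avg R) = ennreal (1 / R) * (\<integral>\<^sup>+y. \<phi> y * indicator {0..<R} (y + c * of_int n) \<partial>lborel)"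
      using R by (simp add: nn_integral_interval_avg)
  qed
  also have "\<dots> = ennreal (1 / R) * (\<Sum>\<^sub>\<int> n. \<integral>\<^sup>+y. \<phi> y * indicator {0..<R} (y + c * of_int n) \<partial>lborel)"
    by (rule int_sum_cmult)
  also have "(\<Sum>\<^sub>\<int> n. \<integral>\<^sup>+y. \<phi> y * indicator {0..<R} (y + c * of_int n) \<partial>lborel) = 
     (\<integral>\<^sup>+y. (\<Sum>\<^sub>\<int> n. \<phi> y * indicator {0..<R} (y + c * of_int n)) \<partial>lborel)"
    by (rule nn_integral_int_sum[symmetric]) auto
  finally show ?thesis unfolding int_sum_cmult .
qed

lemma interval_avg_periodization_upper:
  assumes [measurable]: "\<phi> \<in> borel_measurable borel" and c: "c > 0" and R: "R > 0"
  shows "(\<integral>\<^sup>+r. (\<Sum>\<^sub>\<int> n. \<phi> (r - c * of_int n)) \<partial>interval_avg R) \<le> ennreal (1 / c + 1 / R) * (\<integral>\<^sup>+y. \<phi> y \<partial>lborel)"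
proof -
  have "(\<integral>\<^sup>+r. (\<Sum>\<^sub>\<int> n. \<phi> (r - c * of_int n)) \<partial>interval_avg R)
     \<le> ennreal (1 / R) * (\<integral>\<^sup>+y. \<phi> y * ennreal (R / c + 1) \<partial>lborel)"
    unfolding interval_avg_periodization[OF assms(1) R]
    using lattice_count_bounds[OF c R] by (intro mult_left_mono nn_integral_mono) auto
  also have "\<dots> = ennreal (1 / R) * ennreal (R / c + 1) * (\<integral>\<^sup>+y. \<phi> y \<partial>lborel)"
    by (simp add: nn_integral_multc mult_ac)
  also have "ennreal (1 / R) * ennreal (R / c + 1) = ennreal (1 / c + 1 / R)"
    using c R by (subst ennreal_mult[symmetric]) (auto simp: field_simps)
  finally show ?thesis .
qed

lemma interval_avg_periodization_lower:
  assumes [measurable]: "\<phi> \<in> borel_measurable borel" and c: "c > 0" and R: "R > 0"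
  shows "ennreal (1 / c - 1 / R) * (\<integral>\<^sup>+y. \<phi> y \<partial>lborel) \<le> (\<integral>\<^sup>+r. (\<Sum>\<^sub>\<int> n. \<phi> (r - c * of_int n)) \<partial>interval_avg R)"
proof -
  have "1 / c - 1 / R = 1 / R * (R / c - 1)"
    using c R by (simp add: field_simps)
  then have "ennreal (1 / c - 1 / R) = ennreal (1 / R) * ennreal (R / c - 1)"
    using R ennreal_mult'[of "1 / R" "R / c - 1"] by simp
  then have "ennreal (1 / c - 1 / R) * (\<integral>\<^sup>+y. \<phi> y \<partial>lborel) = ennreal (1 / R) * (\<integral>\<^sup>+y. \<phi> y * ennreal (R / c - 1) \<partial>lborel)"
    by (simp add: nn_integral_multc mult_ac)
  also have "\<dots> \<le> (\<integral>\<^sup>+r. (\<Sum>\<^sub>\<int> n. \<phi> (r - c * of_int n)) \<partial>interval_avg R)"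
    unfolding interval_avg_periodization[OF assms(1) R]
    using lattice_count_bounds[OF c R] by (intro mult_left_mono nn_integral_mono) auto
  finally show ?thesis .
qed

text \<open>The sum over the lattice is sheared: moving \<open>That p q r f\<close> past \<open>That k l m g\<close> changes the central
  coordinate by \<open>(q - l) k\<close>. The index set is a subgroup of the Heisenberg group only for
  special steps. Its averages can nevertheless be computed one coordinate at a time: \<open>r\<close> is averaged
  first, and the integral over all \<open>r\<close> is invariant under the shear.\<close>

locale heisenberg_periodization =
  fixes \<Phi> :: "real \<Rightarrow> real \<Rightarrow> real \<Rightarrow> ennreal" and c1 c2 c3 R :: real
  assumes Phi_measurable: "(\<lambda>(p, q, r). \<Phi> p q r) \<in> borel_measurable borel"
    and pos: "c1 > 0" "c2 > 0" "c3 > 0" "R > 0"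
begin

lemma Phi_comp_measurable [measurable (raw)]:
  assumes "f \<in> borel_measurable M" "g \<in> borel_measurable M" "h \<in> borel_measurable M"
  shows "(\<lambda>x. \<Phi> (f x) (g x) (h x)) \<in> borel_measurable M"
proof -
  have [measurable]: "(\<lambda>x. (f x, g x, h x)) \<in> borel_measurable M"
    using assms by (intro borel_measurable_Pair) auto
  show ?thesis
    using measurable_compose[OF _ Phi_measurable, of "\<lambda>x. (f x, g x, h x)" M] by simp
qed

definition periodized :: "real \<Rightarrow> real \<Rightarrow> real \<Rightarrow> ennreal" where
  "periodized p q r = (\<Sum>\<^sub>\<int> a. \<Sum>\<^sub>\<int> b. \<Sum>\<^sub>\<int> c.
     \<Phi> (p - c1 * of_int a) (q - c2 * of_int b)
       (r - c3 * of_int c - (q - c2 * of_int b) * (c1 * of_int a)))"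

lemma periodized_measurable [measurable (raw)]:
  assumes [measurable]: "f \<in> borel_measurable M" "g \<in> borel_measurable M" "h \<in> borel_measurable M"
  shows "(\<lambda>x. periodized (f x) (g x) (h x)) \<in> borel_measurable M"
  unfolding periodized_def by measurable

definition mean :: ennreal where
  "mean = (\<integral>\<^sup>+p. \<integral>\<^sup>+q. \<integral>\<^sup>+r. periodized p q r \<partial>interval_avg R \<partial>interval_avg R \<partial>interval_avg R)"

sublocale avg: prob_space "interval_avg R"
  using pos by (intro prob_space_interval_avg)

text \<open>The average over \<open>r\<close> moves inside the sums over \<open>a\<close> and \<open>b\<close>, the average over \<open>q\<close> inside the sum over
  \<open>a\<close>. Every average then stands next to the sum over its own coordinate, and the one-dimensional estimates can be applied from the inside out.\<close>

lemma mean_swap: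
  "mean = (\<integral>\<^sup>+p. \<Sum>\<^sub>\<int> a. \<integral>\<^sup>+q. \<Sum>\<^sub>\<int> b. \<integral>\<^sup>+r. \<Sum>\<^sub>\<int> c.
     \<Phi> (p - c1 * of_int a) (q - c2 * of_int b)
       (r - c3 * of_int c - (q - c2 * of_int b) * (c1 * of_int a))
     \<partial>interval_avg R \<partial>interval_avg R \<partial>interval_avg R)"
proof -
  let ?U = "interval_avg R"
  let ?F = "\<lambda>p q r a b c. \<Phi> (p - c1 * of_int a) (q - c2 * of_int b)
       (r - c3 * of_int c - (q - c2 * of_int b) * (c1 * of_int a))"
  have r: "(\<integral>\<^sup>+r. \<Sum>\<^sub>\<int> a. \<Sum>\<^sub>\<int> b. \<Sum>\<^sub>\<int> c. ?F p q r a b c \<partial>?U)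
      = (\<Sum>\<^sub>\<int> a. \<Sum>\<^sub>\<int> b. \<integral>\<^sup>+r. \<Sum>\<^sub>\<int> c. ?F p q r a b c \<partial>?U)" for p q
    by (simp add: nn_integral_int_sum)
  have q: "(\<integral>\<^sup>+q. \<Sum>\<^sub>\<int> a. \<Sum>\<^sub>\<int> b. \<integral>\<^sup>+r. \<Sum>\<^sub>\<int> c. ?F p q r a b c \<partial>?U \<partial>?U)
      = (\<Sum>\<^sub>\<int> a. \<integral>\<^sup>+q. \<Sum>\<^sub>\<int> b. \<integral>\<^sup>+r. \<Sum>\<^sub>\<int> c. ?F p q r a b c \<partial>?U \<partial>?U)" for p
    by (simp add: nn_integral_int_sum)
  show ?thesis
    unfolding mean_def periodized_def r q ..
qed

lemma mean_upper:
  "mean \<le> ennreal ((1 / c1 + 1 / R) * (1 / c2 + 1 / R) * (1 / c3 + 1 / R)) *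
      (\<integral>\<^sup>+p. \<integral>\<^sup>+q. \<integral>\<^sup>+r. \<Phi> p q r \<partial>lborel \<partial>lborel \<partial>lborel)" 
proof -
  let ?U = "interval_avg R"
  let ?k1 = "ennreal (1 / c1 + 1 / R)" and ?k2 = "ennreal (1 / c2 + 1 / R)" and ?k3 = "ennreal (1 / c3 + 1 / R)"
  have A: "(\<integral>\<^sup>+r. \<Sum>\<^sub>\<int> c. \<Phi> p q (r - c3 * of_int c - s) \<partial>?U) \<le> ?k3 * (\<integral>\<^sup>+r. \<Phi> p q r \<partial>lborel)" for p q s
    using interval_avg_periodization_upper[of "\<lambda>r. \<Phi> p q (r - s)" c3 R] pos nn_integral_translate[of "\<Phi> p q" s]
    by simp
  have B: "(\<integral>\<^sup>+q. \<Sum>\<^sub>\<int> b. ?k3 * (\<integral>\<^sup>+r. \<Phi> p (q - c2 * of_int b) r \<partial>lborel) \<partial>?U) \<le> 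
      ?k2 * (?k3 * (\<integral>\<^sup>+q. \<integral>\<^sup>+r. \<Phi> p q r \<partial>lborel \<partial>lborel))" for p
  proof -
    have "(\<integral>\<^sup>+q. ?k3 * (\<integral>\<^sup>+r. \<Phi> p q r \<partial>lborel) \<partial>lborel) = ?k3 * (\<integral>\<^sup>+q. \<integral>\<^sup>+r. \<Phi> p q r \<partial>lborel \<partial>lborel)"
      by (rule nn_integral_cmult) measurable
    moreover have "(\<lambda>q. ?k3 * (\<integral>\<^sup>+r. \<Phi> p q r \<partial>lborel)) \<in> borel_measurable borel" by measurable
    ultimately show ?thesis using interval_avg_periodization_upper[OF _ pos(2,4), of "\<lambda>q. ?k3 * (\<integral>\<^sup>+r. \<Phi> p q r \<partial>lborel)"] by argo
  qed
  have C: "(\<integral>\<^sup>+p. \<Sum>\<^sub>\<int> a. ?k2 * (?k3 * (\<integral>\<^sup>+q. \<integral>\<^sup>+r. \<Phi> (p - c1 * of_int a) q r \<partial>lborel \<partial>lborel)) \<partial>?U) \<le> 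
      ?k1 * (?k2 * (?k3 * (\<integral>\<^sup>+p. \<integral>\<^sup>+q. \<integral>\<^sup>+r. \<Phi> p q r \<partial>lborel \<partial>lborel \<partial>lborel)))"
  proof -
    let ?\<phi> = "\<lambda>p. ?k2 * (?k3 * (\<integral>\<^sup>+q. \<integral>\<^sup>+r. \<Phi> p q r \<partial>lborel \<partial>lborel))"
    have "(\<integral>\<^sup>+p. ?\<phi> p \<partial>lborel) = ?k2 * (\<integral>\<^sup>+p. ?k3 * (\<integral>\<^sup>+q. \<integral>\<^sup>+r. \<Phi> p q r \<partial>lborel \<partial>lborel) \<partial>lborel)"
      by (rule nn_integral_cmult) measurable
    also have "(\<integral>\<^sup>+p. ?k3 * (\<integral>\<^sup>+q. \<integral>\<^sup>+r. \<Phi> p q r \<partial>lborel \<partial>lborel) \<partial>lborel) = ?k3 * (\<integral>\<^sup>+p. \<integral>\<^sup>+q. \<integral>\<^sup>+r. \<Phi> p q r \<partial>lborel \<partial>lborel \<partial>lborel)"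
      by (rule nn_integral_cmult) measurable
    finally have "(\<integral>\<^sup>+p. ?\<phi> p \<partial>lborel) = ?k2 * (?k3 * (\<integral>\<^sup>+p. \<integral>\<^sup>+q. \<integral>\<^sup>+r. \<Phi> p q r \<partial>lborel \<partial>lborel \<partial>lborel))" .
    moreover have "?\<phi> \<in> borel_measurable borel" by measurable
    ultimately show ?thesis using interval_avg_periodization_upper[OF _ pos(1,4), of ?\<phi>] by argo
  qed
  have "mean \<le> ?k1 * (?k2 * (?k3 * (\<integral>\<^sup>+p. \<integral>\<^sup>+q. \<integral>\<^sup>+r. \<Phi> p q r \<partial>lborel \<partial>lborel \<partial>lborel)))"
    unfolding mean_swap
    by (intro order_trans[OF _ C] nn_integral_mono int_sum_mono order_trans[OF _ B] A)
  also have "\<dots> = ennreal ((1 / c1 + 1 / R) * (1 / c2 + 1 / R) * (1 / c3 + 1 / R)) *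
      (\<integral>\<^sup>+p. \<integral>\<^sup>+q. \<integral>\<^sup>+r. \<Phi> p q r \<partial>lborel \<partial>lborel \<partial>lborel)"
    using pos by (simp add: ennreal_mult mult.assoc)
  finally show ?thesis .
qed

lemma mean_lower:
  assumes "R \<ge> c1" "R \<ge> c2" "R \<ge> c3"
  shows "ennreal ((1 / c1 - 1 / R) * (1 / c2 - 1 / R) * (1 / c3 - 1 / R)) *
      (\<integral>\<^sup>+p. \<integral>\<^sup>+q. \<integral>\<^sup>+r. \<Phi> p q r \<partial>lborel \<partial>lborel \<partial>lborel) \<le> mean" 
proof -
  let ?U = "interval_avg R"
  let ?k1 = "ennreal (1 / c1 - 1 / R)" and ?k2 = "ennreal (1 / c2 - 1 / R)" and ?k3 = "ennreal (1 / c3 - 1 / R)"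
  have A: "?k3 * (\<integral>\<^sup>+r. \<Phi> p q r \<partial>lborel) \<le> (\<integral>\<^sup>+r. \<Sum>\<^sub>\<int> c. \<Phi> p q (r - c3 * of_int c - s) \<partial>?U)" for p q s
    using interval_avg_periodization_lower[of "\<lambda>r. \<Phi> p q (r - s)" c3 R] pos nn_integral_translate[of "\<Phi> p q" s]
    by simp
  have B: "?k2 * (?k3 * (\<integral>\<^sup>+q. \<integral>\<^sup>+r. \<Phi> p q r \<partial>lborel \<partial>lborel)) \<le>
     (\<integral>\<^sup>+q. \<Sum>\<^sub>\<int> b. ?k3 * (\<integral>\<^sup>+r. \<Phi> p (q - c2 * of_int b) r \<partial>lborel) \<partial>?U)" for p
  proof -
    have "(\<integral>\<^sup>+q. ?k3 * (\<integral>\<^sup>+r. \<Phi> p q r \<partial>lborel) \<partial>lborel) = ?k3 * (\<integral>\<^sup>+q. \<integral>\<^sup>+r. \<Phi> p q r \<partial>lborel \<partial>lborel)"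
      by (rule nn_integral_cmult) measurable
    moreover have "(\<lambda>q. ?k3 * (\<integral>\<^sup>+r. \<Phi> p q r \<partial>lborel)) \<in> borel_measurable borel" by measurable
    ultimately show ?thesis using interval_avg_periodization_lower[OF _ pos(2,4), of "\<lambda>q. ?k3 * (\<integral>\<^sup>+r. \<Phi> p q r \<partial>lborel)"] by argo
  qed
  have C: "?k1 * (?k2 * (?k3 * (\<integral>\<^sup>+p. \<integral>\<^sup>+q. \<integral>\<^sup>+r. \<Phi> p q r \<partial>lborel \<partial>lborel \<partial>lborel))) \<le>
     (\<integral>\<^sup>+p. \<Sum>\<^sub>\<int> a. ?k2 * (?k3 * (\<integral>\<^sup>+q. \<integral>\<^sup>+r. \<Phi> (p - c1 * of_int a) q r \<partial>lborel \<partial>lborel)) \<partial>?U)"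
  proof -
    let ?\<phi> = "\<lambda>p. ?k2 * (?k3 * (\<integral>\<^sup>+q. \<integral>\<^sup>+r. \<Phi> p q r \<partial>lborel \<partial>lborel))"
    have "(\<integral>\<^sup>+p. ?\<phi> p \<partial>lborel) = ?k2 * (\<integral>\<^sup>+p. ?k3 * (\<integral>\<^sup>+q. \<integral>\<^sup>+r. \<Phi> p q r \<partial>lborel \<partial>lborel) \<partial>lborel)"
      by (rule nn_integral_cmult) measurable
    also have "(\<integral>\<^sup>+p. ?k3 * (\<integral>\<^sup>+q. \<integral>\<^sup>+r. \<Phi> p q r \<partial>lborel \<partial>lborel) \<partial>lborel) = ?k3 * (\<integral>\<^sup>+p. \<integral>\<^sup>+q. \<integral>\<^sup>+r. \<Phi> p q r \<partial>lborel \<partial>lborel \<partial>lborel)"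
      by (rule nn_integral_cmult) measurable
    finally have "(\<integral>\<^sup>+p. ?\<phi> p \<partial>lborel) = ?k2 * (?k3 * (\<integral>\<^sup>+p. \<integral>\<^sup>+q. \<integral>\<^sup>+r. \<Phi> p q r \<partial>lborel \<partial>lborel \<partial>lborel))" .
    moreover have "?\<phi> \<in> borel_measurable borel" by measurable
    ultimately show ?thesis using interval_avg_periodization_lower[OF _ pos(1,4), of ?\<phi>] by argo
  qed
  have nonneg: "0 \<le> 1 / c1 - 1 / R" "0 \<le> 1 / c2 - 1 / R" "0 \<le> 1 / c3 - 1 / R"
    using assms pos by (auto simp: field_simps)
  have "ennreal ((1 / c1 - 1 / R) * (1 / c2 - 1 / R) * (1 / c3 - 1 / R)) *
      (\<integral>\<^sup>+p. \<integral>\<^sup>+q. \<integral>\<^sup>+r. \<Phi> p q r \<partial>lborel \<partial>lborel \<partial>lborel) = 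
     ?k1 * (?k2 * (?k3 * (\<integral>\<^sup>+p. \<integral>\<^sup>+q. \<integral>\<^sup>+r. \<Phi> p q r \<partial>lborel \<partial>lborel \<partial>lborel)))"
    using nonneg by (simp add: ennreal_mult mult.assoc)
  also have "\<dots> \<le> mean"
    unfolding mean_swap
    by (intro order_trans[OF C] nn_integral_mono int_sum_mono order_trans[OF B] A)
  finally show ?thesis .
qed

end

section \<open>Orthogonality relations for the Heisenberg operators\<close>

lemma That_cis:
  "That k l m g (x, t) = cis (2 * pi * m * x) * cis (- (2 * pi * (x * l) * t)) * g (x, t - k)"
  by (simp add: That_def cis_conv_exp mult_ac)

definition coeff :: "(real \<times> real \<Rightarrow> complex) \<Rightarrow> (real \<times> real \<Rightarrow> complex) \<Rightarrow> complex" where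
  "coeff f g = (LINT z|lborel. complex_of_real \<bar>fst z\<bar> * (f z * cnj (g z)))"

lemma That_measurable [measurable]:
  assumes [measurable]: "g \<in> borel_measurable (borel \<Otimes>\<^sub>M borel)"
  shows "That k l m g \<in> borel_measurable (borel \<Otimes>\<^sub>M borel)"
proof -
  have "That k l m g = (\<lambda>(x, t). cis (2 * pi * m * x) * cis (- (2 * pi * (x * l) * t)) * g (x, t - k))"
    by (auto simp: That_cis)
  then show ?thesis by simp
qed

text \<open>The commutation rule of the Heisenberg operators, read off after the change of variable
  \<open>t \<mapsto> t + k\<close>.\<close>

lemma coeff_That:
  assumes [measurable]: "f \<in> borel_measurable (borel \<Otimes>\<^sub>M borel)" "g \<in> borel_measurable (borel \<Otimes>\<^sub>M borel)"
  shows "coeff (That p q r f) (That k l m g) = coeff (That (p - k) (q - l) (r - m - (q - l) * k) f) g"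
proof -
  let ?H = "\<lambda>z. complex_of_real \<bar>fst z\<bar> * (That p q r f z * cnj (That k l m g z))"
  have "?H \<in> borel_measurable (borel \<Otimes>\<^sub>M borel)" by measurable
  then have [measurable]: "?H \<in> borel_measurable borel" by (simp add: borel_prod)
  have "coeff (That p q r f) (That k l m g) = (LINT z|distr lborel borel ((+) (0, k)). ?H z)"
    unfolding coeff_def lborel_distr_plus ..
  also have "\<dots> = (LINT z|lborel. ?H ((0, k) + z))"
    by (rule integral_distr) auto
  also have "\<dots> = coeff (That (p - k) (q - l) (r - m - (q - l) * k) f) g"
    unfolding coeff_def
  proof (intro Bochner_Integration.integral_cong refl)
    fix z :: "real \<times> real"
    obtain x t where z: "z = (x, t)" by (cases z)
    have "cis (2 * pi * r * x) * cis (- (2 * pi * (x * q) * (k + t))) *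
        cnj (cis (2 * pi * m * x) * cis (- (2 * pi * (x * l) * (k + t)))) =
      cis (2 * pi * (r - m - (q - l) * k) * x) * cis (- (2 * pi * (x * (q - l)) * t))"
      unfolding complex_cnj_mult cis_cnj cis_mult
      by (rule arg_cong[of _ _ cis]) (simp add: algebra_simps)
    then show "?H ((0, k) + z) = complex_of_real \<bar>fst z\<bar> * (That (p - k) (q - l) (r - m - (q - l) * k) f z * cnj (g z))"
      by (simp add: z That_cis algebra_simps)
  qed
  finally show ?thesis .
qed

lemma le_one_plus_square: "a \<le> 1 + a\<^sup>2" for a :: real
  using zero_le_power2[of "a - 1/2"] by (simp add: power2_eq_square algebra_simps)

text \<open>One of the two functions is bounded with support in a box away from the line \<open>x = 0\<close>. This makes
  all functions whose Fourier transforms occur integrable as well as square integrable, for every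
  \<open>g\<close> of finite weighted norm.\<close>

locale heisenberg_orthogonality =
  fixes f g :: "real \<times> real \<Rightarrow> complex" and C :: real
  assumes f_meas [measurable]: "f \<in> borel_measurable (borel \<Otimes>\<^sub>M borel)"
    and g_meas [measurable]: "g \<in> borel_measurable (borel \<Otimes>\<^sub>M borel)"
    and f_bound: "\<And>z. cmod (f z) \<le> C"
    and f_support: "\<And>x t. f (x, t) \<noteq> 0 \<Longrightarrow> 1 \<le> \<bar>x\<bar> \<and> \<bar>x\<bar> \<le> 2 \<and> 0 \<le> t \<and> t \<le> 1"
    and g_fin: "(\<integral>\<^sup>+x. \<integral>\<^sup>+t. ennreal (\<bar>x\<bar> * (cmod (g (x, t)))\<^sup>2) \<partial>lborel \<partial>lborel) < \<infinity>"
begin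

text \<open>The product whose Fourier transform in \<open>t\<close> carries the dependence on the frequency shift \<open>q\<close>.\<close>

definition U :: "real \<Rightarrow> real \<Rightarrow> real \<Rightarrow> complex" where
  "U p x t = f (x, t - p) * cnj (g (x, t))"

lemma U_measurable [measurable (raw)]:
  assumes [measurable]: "a \<in> borel_measurable M" "b \<in> borel_measurable M" "c \<in> borel_measurable M"
  shows "(\<lambda>z. U (a z) (b z) (c z)) \<in> borel_measurable M"
  unfolding U_def by measurable

lemma fourier_U_measurable [measurable (raw)]:
  assumes [measurable]: "a \<in> borel_measurable M" "b \<in> borel_measurable M" "c \<in> borel_measurable M"
  shows "(\<lambda>z. fourier (U (a z) (b z)) (c z)) \<in> borel_measurable M"
  unfolding fourier_def by measurable

lemma C_nonneg: "0 \<le> C"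
  using f_bound[of undefined] norm_ge_zero order_trans by blast

lemma f_bound_strip: "cmod (f (x, t - p)) \<le> C * indicator {p..p+1} t"
  using f_bound[of "(x, t - p)"] f_support[of x "t - p"] C_nonneg
  by (cases "f (x, t - p) = 0") (auto simp: indicator_def)

lemma f_bound_box: "cmod (f (x, t - p)) \<le> C * indicator (cbox (-2, p) (2, p+1)) (x, t)"
  using f_bound[of "(x, t - p)"] f_support[of x "t - p"] C_nonneg
  by (cases "f (x, t - p) = 0") (auto simp: indicator_def cbox_Pair_eq)

lemma weighted_g_integrable: "integrable lborel (\<lambda>z. \<bar>fst z\<bar> * (cmod (g z))\<^sup>2)"
proof (rule integrableI_bounded)
  show "(\<lambda>z. \<bar>fst z\<bar> * (cmod (g z))\<^sup>2) \<in> borel_measurable lborel"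
    unfolding lborel_prod[symmetric] by measurable
  have "(\<integral>\<^sup>+z. ennreal (norm (\<bar>fst z\<bar> * (cmod (g z))\<^sup>2)) \<partial>lborel) =
    (\<integral>\<^sup>+x. \<integral>\<^sup>+t. ennreal (\<bar>x\<bar> * (cmod (g (x, t)))\<^sup>2) \<partial>lborel \<partial>lborel)"
    unfolding lborel_prod[symmetric]
    by (subst lborel.nn_integral_fst[symmetric]) (simp_all add: abs_mult)
  then show "(\<integral>\<^sup>+z. ennreal (norm (\<bar>fst z\<bar> * (cmod (g z))\<^sup>2)) \<partial>lborel) < \<infinity>"
    using g_fin by simp
qed

lemma modulated_integrable:
  assumes [measurable]: "e \<in> borel_measurable (borel \<Otimes>\<^sub>M borel)" and e: "\<And>z. cmod (e z) \<le> 1"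
  shows "integrable (lborel \<Otimes>\<^sub>M lborel) (\<lambda>(x, t). e (x, t) * (complex_of_real \<bar>x\<bar> * U p x t))"
proof (rule Bochner_Integration.integrable_bound)
  show "integrable (lborel \<Otimes>\<^sub>M lborel) (\<lambda>z. C * (2 * indicator (cbox (-2, p) (2, p+1)) z + \<bar>fst z\<bar> * (cmod (g z))\<^sup>2))"
    unfolding lborel_prod
  proof (intro integrable_mult_right Bochner_Integration.integrable_add weighted_g_integrable)
    show "integrable lborel (indicator (cbox (-2, p) (2, p+1)) :: real \<times> real \<Rightarrow> real)"
      using emeasure_bounded_finite[OF bounded_cbox, of "(-2, p)" "(2, p+1)"]
      unfolding integrable_indicator_iff by simp
  qed
  show "(\<lambda>(x, t). e (x, t) * (complex_of_real \<bar>x\<bar> * U p x t)) \<in> borel_measurable (lborel \<Otimes>\<^sub>M lborel)"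
    by measurable
  have "cmod (e (x, t) * (complex_of_real \<bar>x\<bar> * U p x t)) \<le>
     C * (2 * indicator (cbox (-2, p) (2, p+1)) (x, t) + \<bar>x\<bar> * (cmod (g (x, t)))\<^sup>2)" for x t
  proof -
    let ?I = "indicator (cbox (-2, p) (2, p+1)) (x, t) :: real"
    have "cmod (e (x, t) * (complex_of_real \<bar>x\<bar> * U p x t)) \<le> 1 * (\<bar>x\<bar> * ((C * ?I) * cmod (g (x, t))))"
      unfolding norm_mult U_def
      by (intro mult_mono e f_bound_box) (auto simp: C_nonneg)
    also have "\<dots> \<le> C * (?I * \<bar>x\<bar> * (1 + (cmod (g (x, t)))\<^sup>2))"
      using le_one_plus_square[of "cmod (g (x, t))"] C_nonneg
      by (auto simp: indicator_def mult_left_mono mult.left_commute intro!: mult_left_mono)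
    also have "\<dots> \<le> C * (2 * ?I + \<bar>x\<bar> * (cmod (g (x, t)))\<^sup>2)"
      using C_nonneg by (intro mult_left_mono) (auto simp: indicator_def cbox_Pair_eq algebra_simps)
    finally show ?thesis .
  qed
  then show "AE z in lborel \<Otimes>\<^sub>M lborel. norm (case z of (x, t) \<Rightarrow> e (x, t) * (complex_of_real \<bar>x\<bar> * U p x t))
    \<le> norm (C * (2 * indicator (cbox (-2, p) (2, p+1)) z + \<bar>fst z\<bar> * (cmod (g z))\<^sup>2))"
    by (intro AE_I2) (force split: prod.split intro: order_trans[OF _ abs_ge_self])
qed

text \<open>The inner integral of a coefficient; its Fourier transform in \<open>x\<close> carries the dependence on \<open>r\<close>.\<close>

definition h :: "real \<Rightarrow> real \<Rightarrow> real \<Rightarrow> complex" where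
  "h p q x = complex_of_real \<bar>x\<bar> * fourier (U p x) (- (x * q))"

lemma h_measurable [measurable (raw)]:
  assumes [measurable]: "a \<in> borel_measurable M" "b \<in> borel_measurable M" "c \<in> borel_measurable M"
  shows "(\<lambda>z. h (a z) (b z) (c z)) \<in> borel_measurable M"
  unfolding h_def by measurable

lemma coeff_eq_fourier: "coeff (That p q r f) g = fourier (h p q) r"
proof -
  let ?e = "\<lambda>(x, t). cis (2 * pi * r * x) * cis (- (2 * pi * (x * q) * t))"
  have I: "integrable (lborel \<Otimes>\<^sub>M lborel) (\<lambda>(x, t). ?e (x, t) * (complex_of_real \<bar>x\<bar> * U p x t))"
    by (rule modulated_integrable) (auto simp: norm_mult)
  have "coeff (That p q r f) g = (LINT z|(lborel \<Otimes>\<^sub>M lborel). (case z of (x, t) \<Rightarrow> ?e (x, t) * (complex_of_real \<bar>x\<bar> * U p x t)))"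
    unfolding coeff_def lborel_prod
    by (intro Bochner_Integration.integral_cong) (auto simp: That_cis U_def)
  also have "\<dots> = (LINT x|lborel. LINT t|lborel. ?e (x, t) * (complex_of_real \<bar>x\<bar> * U p x t))"
    using lborel_pair.integral_fst'[OF I] by simp
  also have "\<dots> = (LINT x|lborel. LINT t|lborel. (cis (2 * pi * r * x) * complex_of_real \<bar>x\<bar>) * (cis (2 * pi * - (x * q) * t) * U p x t))"
    by (intro Bochner_Integration.integral_cong refl) (simp add: mult_ac)
  also have "\<dots> = (LINT x|lborel. (cis (2 * pi * r * x) * complex_of_real \<bar>x\<bar>) * (LINT t|lborel. cis (2 * pi * - (x * q) * t) * U p x t))"
    by (intro Bochner_Integration.integral_cong refl Bochner_Integration.integral_mult_right_zero)
  also have "\<dots> = fourier (h p q) r"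
    unfolding fourier_def h_def mult.assoc ..
  finally show ?thesis .
qed

lemma h_integrable: "integrable lborel (h p q)"
proof -
  let ?e = "\<lambda>(x, t). cis (- (2 * pi * (x * q) * t))"
  have I: "integrable (lborel \<Otimes>\<^sub>M lborel) (\<lambda>(x, t). ?e (x, t) * (complex_of_real \<bar>x\<bar> * U p x t))"
    by (rule modulated_integrable) auto
  have "(LINT t|lborel. ?e (x, t) * (complex_of_real \<bar>x\<bar> * U p x t)) = h p q x" for x
  proof -
    have "(LINT t|lborel. ?e (x, t) * (complex_of_real \<bar>x\<bar> * U p x t)) = 
       (LINT t|lborel. complex_of_real \<bar>x\<bar> * (cis (2 * pi * - (x * q) * t) * U p x t))"
      by (intro Bochner_Integration.integral_cong refl) (simp add: mult_ac)
    also have "\<dots> = h p q x"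
      unfolding h_def fourier_def by (rule Bochner_Integration.integral_mult_right_zero)
    finally show ?thesis .
  qed
  then show ?thesis using lborel_pair.integrable_fst'[OF I] by simp
qed

definition Ng :: "real \<Rightarrow> ennreal" where "Ng x = (\<integral>\<^sup>+t. ennreal ((cmod (g (x, t)))\<^sup>2) \<partial>lborel)"
definition Nf :: "real \<Rightarrow> ennreal" where "Nf x = (\<integral>\<^sup>+t. ennreal ((cmod (f (x, t)))\<^sup>2) \<partial>lborel)"

lemma Ng_measurable [measurable]: "Ng \<in> borel_measurable borel"
  and Nf_measurable [measurable]: "Nf \<in> borel_measurable borel"
proof -
  have "Ng \<in> borel_measurable lborel" "Nf \<in> borel_measurable lborel"
    unfolding Ng_def Nf_def by measurable
  then show "Ng \<in> borel_measurable borel" "Nf \<in> borel_measurable borel" by auto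
qed

lemma weighted_Ng_finite: "(\<integral>\<^sup>+x. ennreal \<bar>x\<bar> * Ng x \<partial>lborel) < \<infinity>"
proof -
  have "(\<integral>\<^sup>+x. ennreal \<bar>x\<bar> * Ng x \<partial>lborel) = (\<integral>\<^sup>+x. \<integral>\<^sup>+t. ennreal (\<bar>x\<bar> * (cmod (g (x, t)))\<^sup>2) \<partial>lborel \<partial>lborel)"
    unfolding Ng_def by (intro nn_integral_cong) (simp add: nn_integral_cmult ennreal_mult)
  then show ?thesis using g_fin by simp
qed

text \<open>Plancherel's identity in \<open>t\<close> is available only on the fibres where \<open>g\<close> is square integrable, which
  are almost all of them.\<close>

lemma AE_Ng_finite: "AE x in lborel. x \<noteq> 0 \<and> Ng x < \<infinity>"
proof -
  have "AE x in lborel. ennreal \<bar>x\<bar> * Ng x \<noteq> \<infinity>"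
    by (rule nn_integral_PInf_AE) (use weighted_Ng_finite in auto)
  moreover have "AE x in lborel. (x :: real) \<noteq> 0" by (rule AE_lborel_singleton)
  ultimately show ?thesis
    by eventually_elim (auto simp: ennreal_mult_eq_top_iff less_top)
qed

lemma
  assumes "Ng x < \<infinity>"
  shows U_integrable: "integrable lborel (U p x)"
    and U_square_integrable: "integrable lborel (\<lambda>t. (cmod (U p x t))\<^sup>2)"
proof -
  have G: "integrable lborel (\<lambda>t. (cmod (g (x, t)))\<^sup>2)"
    using assms by (intro integrableI_bounded) (auto simp: Ng_def)
  show "integrable lborel (U p x)"
  proof (rule Bochner_Integration.integrable_bound)
    show "integrable lborel (\<lambda>t. C * (indicator {p..p+1} t + (cmod (g (x, t)))\<^sup>2))"
      using G by auto
    show "AE t in lborel. norm (U p x t) \<le> norm (C * (indicator {p..p+1} t + (cmod (g (x, t)))\<^sup>2))"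
    proof (rule AE_I2)
      fix t
      have "norm (U p x t) \<le> C * indicator {p..p+1} t * cmod (g (x, t))"
        unfolding U_def norm_mult using f_bound_strip by (auto intro!: mult_right_mono)
      also have "\<dots> \<le> C * (indicator {p..p+1} t + (cmod (g (x, t)))\<^sup>2)"
        using C_nonneg le_one_plus_square[of "cmod (g (x, t))"]
        by (auto simp: indicator_def mult_left_mono)
      finally show "norm (U p x t) \<le> norm (C * (indicator {p..p+1} t + (cmod (g (x, t)))\<^sup>2))" by simp
    qed
  qed measurable
  show "integrable lborel (\<lambda>t. (cmod (U p x t))\<^sup>2)"
  proof (rule Bochner_Integration.integrable_bound)
    show "integrable lborel (\<lambda>t. C\<^sup>2 * (cmod (g (x, t)))\<^sup>2)" using G by simp
    have "(cmod (U p x t))\<^sup>2 \<le> C\<^sup>2 * (cmod (g (x, t)))\<^sup>2" for t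
      unfolding U_def norm_mult power_mult_distrib complex_mod_cnj
      using f_bound by (intro mult_right_mono power_mono) auto
    then show "AE t in lborel. norm ((cmod (U p x t))\<^sup>2) \<le> norm (C\<^sup>2 * (cmod (g (x, t)))\<^sup>2)" by simp
  qed measurable
qed

lemma Nf_translate: "(\<integral>\<^sup>+t. ennreal ((cmod (f (x, t - p)))\<^sup>2) \<partial>lborel) = Nf x"
  unfolding Nf_def using nn_integral_translate[of "\<lambda>t. ennreal ((cmod (f (x, t)))\<^sup>2)" p] by simp

lemma Nf_reflect: "(\<integral>\<^sup>+p. ennreal ((cmod (f (x, t - p)))\<^sup>2) \<partial>lborel) = Nf x"
  unfolding Nf_def using nn_integral_real_affine[of "\<lambda>t. ennreal ((cmod (f (x, t)))\<^sup>2)" "-1" t] by simp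

lemma Nf_bound: "ennreal \<bar>x\<bar> * Nf x \<le> ennreal (2 * C\<^sup>2)"
proof (cases "\<bar>x\<bar> \<le> 2")
  case True
  have "Nf x \<le> (\<integral>\<^sup>+t. ennreal (C\<^sup>2) * indicator {0..1::real} t \<partial>lborel)"
    unfolding Nf_def
  proof (rule nn_integral_mono)
    fix t
    have "(cmod (f (x, t)))\<^sup>2 \<le> (C * indicator {0..1} t)\<^sup>2"
      using f_bound_strip[of x t 0] by (intro power_mono) auto
    then show "ennreal ((cmod (f (x, t)))\<^sup>2) \<le> ennreal (C\<^sup>2) * indicator {0..1} t"
      by (auto simp: indicator_def)
  qed
  also have "\<dots> = ennreal (C\<^sup>2)" by (simp add: nn_integral_cmult_indicator)
  finally have "Nf x \<le> ennreal (C\<^sup>2)" .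
  then have "ennreal \<bar>x\<bar> * Nf x \<le> ennreal 2 * ennreal (C\<^sup>2)"
    using ennreal_leI[OF True] by (intro mult_mono) auto
  then show ?thesis by (simp add: ennreal_mult)
next
  case False
  then have "f (x, t) = 0" for t using f_support[of x t] by auto
  then show ?thesis by (simp add: Nf_def)
qed

text \<open>Cauchy-Schwarz on the fibre over \<open>x\<close>.\<close>

lemma h_square_le: "ennreal ((cmod (h p q x))\<^sup>2) \<le> ennreal (2 * C\<^sup>2) * (ennreal \<bar>x\<bar> * Ng x)"
proof -
  have "ennreal (cmod (fourier (U p x) (- (x * q)))) \<le> (\<integral>\<^sup>+t. ennreal (cmod (U p x t)) \<partial>lborel)"
  proof (cases "integrable lborel (\<lambda>t. cis (2 * pi * - (x * q) * t) * U p x t)")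
    case True
    from integral_norm_bound_ennreal[OF True] show ?thesis
      unfolding fourier_def norm_mult by simp
  next
    case False
    then show ?thesis unfolding fourier_def by (simp add: not_integrable_integral_eq)
  qed
  also have "\<dots> = (\<integral>\<^sup>+t. ennreal (cmod (f (x, t - p))) * ennreal (cmod (g (x, t))) \<partial>lborel)"
    by (simp add: U_def norm_mult ennreal_mult)
  finally have "(ennreal (cmod (fourier (U p x) (- (x * q)))))\<^sup>2 \<le> 
      (\<integral>\<^sup>+t. ennreal (cmod (f (x, t - p))) * ennreal (cmod (g (x, t))) \<partial>lborel)\<^sup>2"
    by (rule power_mono) simp
  also have "\<dots> \<le> (\<integral>\<^sup>+t. (ennreal (cmod (f (x, t - p))))\<^sup>2 \<partial>lborel) * (\<integral>\<^sup>+t. (ennreal (cmod (g (x, t))))\<^sup>2 \<partial>lborel)"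
    by (rule Cauchy_Schwarz_nn_integral) measurable
  also have "\<dots> = Nf x * Ng x"
    by (simp add: ennreal_power Nf_translate Ng_def)
  finally have *: "(ennreal (cmod (fourier (U p x) (- (x * q)))))\<^sup>2 \<le> Nf x * Ng x" .
  have "ennreal ((cmod (h p q x))\<^sup>2) = (ennreal \<bar>x\<bar>)\<^sup>2 * (ennreal (cmod (fourier (U p x) (- (x * q)))))\<^sup>2"
    by (simp add: h_def norm_mult power_mult_distrib ennreal_mult ennreal_power)
  also have "\<dots> \<le> (ennreal \<bar>x\<bar>)\<^sup>2 * (Nf x * Ng x)"
    using * by (intro mult_left_mono) auto
  also have "\<dots> = (ennreal \<bar>x\<bar> * Nf x) * (ennreal \<bar>x\<bar> * Ng x)"
    by (simp add: power2_eq_square mult_ac)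
  also have "\<dots> \<le> ennreal (2 * C\<^sup>2) * (ennreal \<bar>x\<bar> * Ng x)"
    by (intro mult_right_mono Nf_bound) auto
  finally show ?thesis .
qed

lemma h_square_integrable: "integrable lborel (\<lambda>x. (cmod (h p q x))\<^sup>2)"
proof (rule integrableI_bounded)
  have "(\<integral>\<^sup>+x. ennreal (norm ((cmod (h p q x))\<^sup>2)) \<partial>lborel) \<le> (\<integral>\<^sup>+x. ennreal (2 * C\<^sup>2) * (ennreal \<bar>x\<bar> * Ng x) \<partial>lborel)"
    by (intro nn_integral_mono) (use h_square_le in simp)
  also have "\<dots> = ennreal (2 * C\<^sup>2) * (\<integral>\<^sup>+x. ennreal \<bar>x\<bar> * Ng x \<partial>lborel)"
    by (rule nn_integral_cmult) measurable
  also have "\<dots> < \<infinity>"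
    using weighted_Ng_finite by (simp add: ennreal_mult_less_top)
  finally show "(\<integral>\<^sup>+x. ennreal (norm ((cmod (h p q x))\<^sup>2)) \<partial>lborel) < \<infinity>" .
qed measurable

text \<open>Plancherel's identity on each fibre. The frequency variable is \<open>- x q\<close>, and the resulting Jacobian
  \<open>1/\<bar>x\<bar>\<close> cancels one of the two factors \<open>\<bar>x\<bar>\<close>.\<close>

lemma nn_integral_q:
  "(\<integral>\<^sup>+q. \<integral>\<^sup>+x. ennreal ((cmod (h p q x))\<^sup>2) \<partial>lborel \<partial>lborel) =
   (\<integral>\<^sup>+x. ennreal \<bar>x\<bar> * (\<integral>\<^sup>+t. ennreal ((cmod (U p x t))\<^sup>2) \<partial>lborel) \<partial>lborel)"
proof -
  have "(\<integral>\<^sup>+q. \<integral>\<^sup>+x. ennreal ((cmod (h p q x))\<^sup>2) \<partial>lborel \<partial>lborel) =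
     (\<integral>\<^sup>+x. \<integral>\<^sup>+q. ennreal ((cmod (h p q x))\<^sup>2) \<partial>lborel \<partial>lborel)"
    by (rule lborel_pair.Fubini') measurable
  also have "\<dots> = (\<integral>\<^sup>+x. ennreal \<bar>x\<bar> * (\<integral>\<^sup>+t. ennreal ((cmod (U p x t))\<^sup>2) \<partial>lborel) \<partial>lborel)"
  proof (rule nn_integral_cong_AE)
    show "AE x in lborel. (\<integral>\<^sup>+q. ennreal ((cmod (h p q x))\<^sup>2) \<partial>lborel) =
       ennreal \<bar>x\<bar> * (\<integral>\<^sup>+t. ennreal ((cmod (U p x t))\<^sup>2) \<partial>lborel)"
      using AE_Ng_finite
    proof eventually_elim
      case (elim x)
      let ?F = "\<lambda>s. ennreal ((cmod (fourier (U p x) s))\<^sup>2)"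
      have "(\<integral>\<^sup>+t. ennreal ((cmod (U p x t))\<^sup>2) \<partial>lborel) = (\<integral>\<^sup>+s. ?F s \<partial>lborel)"
        using elim by (intro plancherel[symmetric] U_integrable U_square_integrable) auto
      also have "\<dots> = ennreal \<bar>x\<bar> * (\<integral>\<^sup>+q. ?F (- (x * q)) \<partial>lborel)"
        using elim nn_integral_real_affine[of ?F "-x" 0] by simp
      finally have "ennreal \<bar>x\<bar> * (\<integral>\<^sup>+t. ennreal ((cmod (U p x t))\<^sup>2) \<partial>lborel) =
         (ennreal \<bar>x\<bar>)\<^sup>2 * (\<integral>\<^sup>+q. ?F (- (x * q)) \<partial>lborel)"
        by (simp add: power2_eq_square mult.assoc)
      also have "\<dots> = (\<integral>\<^sup>+q. (ennreal \<bar>x\<bar>)\<^sup>2 * ?F (- (x * q)) \<partial>lborel)"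
        by (rule nn_integral_cmult[symmetric]) measurable
      also have "\<dots> = (\<integral>\<^sup>+q. ennreal ((cmod (h p q x))\<^sup>2) \<partial>lborel)"
        by (intro nn_integral_cong) (simp add: h_def norm_mult power_mult_distrib ennreal_mult ennreal_power)
      finally show ?case by simp
    qed
  qed
  finally show ?thesis .
qed

text \<open>Integrating over \<open>r\<close>, \<open>q\<close> and \<open>p\<close> in this order uses Plancherel's identity in \<open>x\<close>, Plancherel's
  identity in \<open>t\<close> on every fibre, and translation invariance.\<close>

theorem orthogonality:
  "(\<integral>\<^sup>+p. \<integral>\<^sup>+q. \<integral>\<^sup>+r. ennreal ((cmod (coeff (That p q r f) g))\<^sup>2) \<partial>lborel \<partial>lborel \<partial>lborel) =
   (\<integral>\<^sup>+x. ennreal \<bar>x\<bar> * (Nf x * Ng x) \<partial>lborel)"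
proof -
  have "(\<integral>\<^sup>+p. \<integral>\<^sup>+q. \<integral>\<^sup>+r. ennreal ((cmod (coeff (That p q r f) g))\<^sup>2) \<partial>lborel \<partial>lborel \<partial>lborel) =
     (\<integral>\<^sup>+p. \<integral>\<^sup>+q. \<integral>\<^sup>+x. ennreal ((cmod (h p q x))\<^sup>2) \<partial>lborel \<partial>lborel \<partial>lborel)"
    unfolding coeff_eq_fourier plancherel[OF h_integrable h_square_integrable] ..
  also have "\<dots> = (\<integral>\<^sup>+p. \<integral>\<^sup>+x. ennreal \<bar>x\<bar> * (\<integral>\<^sup>+t. ennreal ((cmod (U p x t))\<^sup>2) \<partial>lborel) \<partial>lborel \<partial>lborel)"
    unfolding nn_integral_q ..
  also have "\<dots> = (\<integral>\<^sup>+x. \<integral>\<^sup>+p. ennreal \<bar>x\<bar> * (\<integral>\<^sup>+t. ennreal ((cmod (U p x t))\<^sup>2) \<partial>lborel) \<partial>lborel \<partial>lborel)"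
    by (rule lborel_pair.Fubini') measurable
  also have "\<dots> = (\<integral>\<^sup>+x. ennreal \<bar>x\<bar> * (Nf x * Ng x) \<partial>lborel)"
  proof (rule nn_integral_cong)
    fix x :: real
    have "(\<integral>\<^sup>+p. ennreal \<bar>x\<bar> * (\<integral>\<^sup>+t. ennreal ((cmod (U p x t))\<^sup>2) \<partial>lborel) \<partial>lborel) =
       ennreal \<bar>x\<bar> * (\<integral>\<^sup>+p. \<integral>\<^sup>+t. ennreal ((cmod (U p x t))\<^sup>2) \<partial>lborel \<partial>lborel)"
      by (rule nn_integral_cmult) measurable
    also have "(\<integral>\<^sup>+p. \<integral>\<^sup>+t. ennreal ((cmod (U p x t))\<^sup>2) \<partial>lborel \<partial>lborel) =
       (\<integral>\<^sup>+t. \<integral>\<^sup>+p. ennreal ((cmod (U p x t))\<^sup>2) \<partial>lborel \<partial>lborel)"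
      by (rule lborel_pair.Fubini') measurable
    also have "\<dots> = (\<integral>\<^sup>+t. Nf x * ennreal ((cmod (g (x, t)))\<^sup>2) \<partial>lborel)"
    proof (rule nn_integral_cong)
      fix t :: real
      have "(\<integral>\<^sup>+p. ennreal ((cmod (U p x t))\<^sup>2) \<partial>lborel) = (\<integral>\<^sup>+p. ennreal ((cmod (f (x, t - p)))\<^sup>2) * ennreal ((cmod (g (x, t)))\<^sup>2) \<partial>lborel)"
        by (intro nn_integral_cong) (simp add: U_def norm_mult power_mult_distrib ennreal_mult)
      also have "\<dots> = (\<integral>\<^sup>+p. ennreal ((cmod (f (x, t - p)))\<^sup>2) \<partial>lborel) * ennreal ((cmod (g (x, t)))\<^sup>2)"
        by (rule nn_integral_multc) measurable
      finally show "(\<integral>\<^sup>+p. ennreal ((cmod (U p x t))\<^sup>2) \<partial>lborel) = Nf x * ennreal ((cmod (g (x, t)))\<^sup>2)"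
        unfolding Nf_reflect .
    qed
    also have "\<dots> = Nf x * Ng x"
      unfolding Ng_def by (rule nn_integral_cmult) measurable
    finally show "(\<integral>\<^sup>+p. ennreal \<bar>x\<bar> * (\<integral>\<^sup>+t. ennreal ((cmod (U p x t))\<^sup>2) \<partial>lborel) \<partial>lborel) =
       ennreal \<bar>x\<bar> * (Nf x * Ng x)" .
  qed
  finally show ?thesis .
qed

end

section \<open>Integration on the frequency-time plane, the index set, and dyadic decompositions\<close>

lemma Lam_strip_borel [measurable]: "Lam \<times> (UNIV :: real set) \<in> sets borel"
proof -
  have "Lam \<times> (UNIV :: real set) \<in> sets (borel \<Otimes>\<^sub>M borel)"
    unfolding Lam_def by (intro pair_measureI) auto
  then show ?thesis unfolding borel_prod .
qed

lemma borel_measurable_LamR_iff: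
  fixes F :: "real \<times> real \<Rightarrow> 'a::real_normed_vector"
  shows "F \<in> borel_measurable LamR \<longleftrightarrow> (\<lambda>z. indicator (Lam \<times> UNIV) z *\<^sub>R F z) \<in> borel_measurable borel"
proof -
  have "F \<in> borel_measurable LamR \<longleftrightarrow> F \<in> borel_measurable (restrict_space lborel (Lam \<times> UNIV))"
    unfolding LamR_def by (intro arg_cong[where f="\<lambda>X. F \<in> X"] measurable_cong_sets) auto
  also have "\<dots> \<longleftrightarrow> (\<lambda>z. indicator (Lam \<times> UNIV) z *\<^sub>R F z) \<in> borel_measurable lborel"
    by (rule borel_measurable_restrict_space_iff) simp
  finally show ?thesis by simp
qed

lemma space_LamR: "space LamR = Lam \<times> UNIV"
  by (simp add: LamR_def space_restrict_space)

lemma borel_measurable_restrict_lborel: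
  "F \<in> borel_measurable borel \<Longrightarrow> F \<in> borel_measurable (restrict_space lborel X)"
  by (rule measurable_restrict_space1) simp

lemma abs_fst_borel: "(\<lambda>z :: real \<times> real. \<bar>fst z\<bar>) \<in> borel_measurable borel"
  by (intro borel_measurable_continuous_onI continuous_intros)

lemma nn_integral_LamR:
  assumes F: "F \<in> borel_measurable borel"
  shows "(\<integral>\<^sup>+z. F z \<partial>LamR) = (\<integral>\<^sup>+x. \<integral>\<^sup>+t. ennreal \<bar>x\<bar> * F (x, t) \<partial>lborel \<partial>lborel)"
proof -
  note abs_fst_borel [measurable]
  note [measurable] = F
  have "(\<integral>\<^sup>+z. F z \<partial>LamR) = (\<integral>\<^sup>+z. ennreal \<bar>fst z\<bar> * F z \<partial>restrict_space lborel (Lam \<times> UNIV))"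
    unfolding LamR_def split_beta'
    by (rule nn_integral_density) (auto intro!: borel_measurable_restrict_lborel)
  also have "\<dots> = (\<integral>\<^sup>+z. ennreal \<bar>fst z\<bar> * F z * indicator (Lam \<times> UNIV) z \<partial>lborel)"
    by (rule nn_integral_restrict_space) simp
  also have "\<dots> = (\<integral>\<^sup>+z. ennreal \<bar>fst z\<bar> * F z \<partial>lborel)"
    by (intro nn_integral_cong) (auto simp: indicator_def Lam_def)
  also have "\<dots> = (\<integral>\<^sup>+x. \<integral>\<^sup>+t. ennreal \<bar>x\<bar> * F (x, t) \<partial>lborel \<partial>lborel)"
    unfolding lborel_prod[symmetric]
    by (subst lborel.nn_integral_fst[symmetric]) (simp_all add: lborel_prod)
  finally show ?thesis .
qed

text \<open>The weight \<open>\<bar>x\<bar>\<close> vanishes on the removed line \<open>x = 0\<close>, so the line can be put back.\<close>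

lemma integral_LamR:
  fixes F :: "real \<times> real \<Rightarrow> complex"
  assumes F: "F \<in> borel_measurable borel"
  shows "(LINT z|LamR. F z) = (LINT z|lborel. complex_of_real \<bar>fst z\<bar> * F z)"
proof -
  have "(LINT z|LamR. F z) = (LINT z|restrict_space lborel (Lam \<times> UNIV). \<bar>fst z\<bar> *\<^sub>R F z)"
    unfolding LamR_def split_beta'
    by (rule integral_density) (auto intro!: borel_measurable_restrict_lborel abs_fst_borel F)
  also have "\<dots> = (LINT z|lborel. indicator (Lam \<times> UNIV) z *\<^sub>R (\<bar>fst z\<bar> *\<^sub>R F z))"
    by (rule integral_restrict_space) simp
  also have "\<dots> = (LINT z|lborel. complex_of_real \<bar>fst z\<bar> * F z)"
    by (intro Bochner_Integration.integral_cong) (auto simp: indicator_def Lam_def scaleR_conv_of_real)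
  finally show ?thesis .
qed

text \<open>Conjugation by a dilation rescales the three parameters, so that the members of scale \<open>j\<close> are
  translates of the single function \<open>Dhat j g\<close>.\<close>

lemma Uhat_eq_That:
  "Uhat g (j, k, l, m) = That (2 powr (of_int j / 2) * k) (2 powr (of_int j / 2) * l) (2 powr (of_int j) * m) (Dhat j g)"
proof
  fix z :: "real \<times> real"
  obtain x t where z: "z = (x, t)" by (cases z)
  let ?u = "2 powr (of_int j / 2 :: real)"
  have u: "2 powi j = ?u * ?u" "2 powr (of_int j :: real) = ?u * ?u" "2 powr (- of_int j / 2 :: real) = inverse ?u" "?u > 0"
    by (simp_all add: powr_minus powr_real_of_int'[symmetric] flip: powr_add)
  have 1: "2 powi j * x * l * (2 powr (- of_int j / 2) * t) = x * (?u * l) * t"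
    unfolding u using u(4) by (simp add: field_simps)
  have 2: "2 powr (- of_int j / 2) * (t - ?u * k) = 2 powr (- of_int j / 2) * t - k"
    unfolding u using u(4) by (simp add: field_simps)
  have 3: "2 * pi * m * (2 powi j * x) = 2 * pi * (2 powr (of_int j) * m) * x"
    unfolding u by simp
  have "Uhat g (j, k, l, m) z = of_real (2 powr (3 * of_int j / 4)) * (cis (2 * pi * m * (2 powi j * x)) *
      cis (- (2 * pi * (2 powi j * x * l * (2 powr (- of_int j / 2) * t)))) * g (2 powi j * x, 2 powr (- of_int j / 2) * t - k))"
    by (simp add: z Uhat_def Dhat_def That_cis mult.assoc)
  also have "\<dots> = That (?u * k) (?u * l) (2 powr (of_int j) * m) (Dhat j g) z"
    unfolding 1 3 z That_cis Dhat_def prod.case 2 by (simp add: mult_ac)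
  finally show "Uhat g (j, k, l, m) z = That (?u * k) (?u * l) (2 powr (of_int j) * m) (Dhat j g) z" .
qed

lemma infsum_eq_nn_integral_count_space:
  fixes f :: "'a \<Rightarrow> real"
  assumes "f summable_on I" "\<And>i. f i \<ge> 0"
  shows "(\<integral>\<^sup>+i. ennreal (f i) \<partial>count_space I) = ennreal (infsum f I)"
proof -
  have "Infinite_Set_Sum.abs_summable_on f I"
    using assms summable_on_iff_abs_summable_on_real abs_summable_equivalent by blast
  then show ?thesis
    using assms by (simp add: nn_integral_conv_infsetsum infsetsum_infsum)
qed

lemma bij_betw_Uhat_index:
  assumes "\<alpha> > 0" "\<beta> > 0"
  shows "bij_betw (\<lambda>(j, a, b, c). (j, \<alpha> * of_int a, \<beta> * of_int b, 1 * of_int c)) UNIV (Uhat_index \<alpha> \<beta> 1)"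
proof -
  have "(\<lambda>(j::int, a::int, b::int, c::int). (j, \<alpha> * of_int a, \<beta> * of_int b, 1 * of_int c :: real)) ` UNIV
     = (Uhat_index \<alpha> \<beta> 1)"
    unfolding Uhat_index_def scaled_ints_def by (auto simp: image_iff)
  moreover have "inj (\<lambda>(j::int, a::int, b::int, c::int). (j, \<alpha> * of_int a, \<beta> * of_int b, 1 * of_int c :: real))"
    using assms by (auto simp: inj_def)
  ultimately show ?thesis by (simp add: bij_betw_def)
qed

lemma nn_integral_Uhat_index:
  assumes "\<alpha> > 0" "\<beta> > 0"
  shows "(\<integral>\<^sup>+i. F i \<partial>count_space (Uhat_index \<alpha> \<beta> 1)) =
    (\<Sum>\<^sub>\<int> j. \<Sum>\<^sub>\<int> a. \<Sum>\<^sub>\<int> b. \<Sum>\<^sub>\<int> c. F (j, \<alpha> * of_int a, \<beta> * of_int b, of_int c))"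
proof -
  have "(\<integral>\<^sup>+i. F i \<partial>count_space (Uhat_index \<alpha> \<beta> 1)) =
     (\<integral>\<^sup>+y. F (case y of (j, a, b, c) \<Rightarrow> (j, \<alpha> * of_int a, \<beta> * of_int b, 1 * of_int c)) \<partial>count_space UNIV)"
    by (rule nn_integral_bij_count_space[OF bij_betw_Uhat_index[OF assms], symmetric])
  then show ?thesis
    by (simp add: int_sum_def nn_integral_fst_count_space[symmetric])
qed

text \<open>The dilates of \<open>[1, 2)\<close> tile the positive half-line; the point \<open>x\<close> lies in the one with
  \<open>j = \<lfloor>log 2 x\<rfloor>\<close>.\<close>

lemma sum_dyadic_indicator:
  fixes x :: real
  shows "(\<Sum>\<^sub>\<int> j. indicator {1..<2} (2 powr (- of_int j) * x)) = indicator {0<..} x"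
proof (cases "x > 0")
  case True
  have "1 \<le> 2 powr (- of_int j) * x \<and> 2 powr (- of_int j) * x < 2 \<longleftrightarrow> j = \<lfloor>log 2 x\<rfloor>" for j :: int
  proof -
    have *: "2 powr (- of_int j) * x = x / 2 powr (of_int j)"
      by (simp add: powr_minus field_simps)
    have "1 \<le> 2 powr (- of_int j) * x \<longleftrightarrow> 2 powr (of_int j) \<le> x"
      unfolding * by (simp add: field_simps)
    also have "\<dots> \<longleftrightarrow> of_int j \<le> log 2 x" using True by (simp add: le_log_iff)
    finally have 1: "1 \<le> 2 powr (- of_int j) * x \<longleftrightarrow> of_int j \<le> log 2 x" .
    have "2 powr (- of_int j) * x < 2 \<longleftrightarrow> x < 2 powr (of_int j + 1)"
      unfolding * by (simp add: field_simps powr_add)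
    also have "\<dots> \<longleftrightarrow> log 2 x < of_int j + 1" using True by (simp add: log_less_iff)
    finally show ?thesis unfolding eq_commute[of j] floor_eq_iff using 1 by auto
  qed
  then have "(\<Sum>\<^sub>\<int> j. indicator {1..<2} (2 powr (- of_int j) * x)) = (\<Sum>\<^sub>\<int> j. indicator {\<lfloor>log 2 x\<rfloor>} j)"
    unfolding int_sum_def by (intro nn_integral_cong) (auto simp: indicator_def)
  then show ?thesis using True by (simp add: int_sum_def)
next
  case False
  then have nonpos: "2 powr (- of_int j) * x \<le> 0" for j :: int
    by (auto simp: mult_le_0_iff)
  have "indicator {1..<2} (2 powr (- of_int j) * x) = (0::ennreal)" for j :: int
    using nonpos[of j] by (simp add: indicator_def)
  then show ?thesis using False by (simp add: int_sum_def)
qed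

lemma nn_integral_inverse_octave:
  "(\<integral>\<^sup>+x. ennreal (1 / x) * indicator {1..<2::real} x \<partial>lborel) = ennreal (ln 2)"
proof -
  have "(\<integral>\<^sup>+x. ennreal (1 / x) * indicator {1..<2::real} x \<partial>lborel) = (\<integral>\<^sup>+x. ennreal (1 / x) * indicator {1..2} x \<partial>lborel)"
    by (intro nn_integral_cong_AE, use AE_lborel_singleton[of "2::real"] in eventually_elim) (auto simp: indicator_def)
  also have "\<dots> = ennreal (ln 2 - ln 1)"
    by (rule nn_integral_FTC_Icc) (auto intro!: derivative_eq_intros)
  finally show ?thesis by simp
qed

section \<open>The averaged frame inequality\<close>

text \<open>With \<open>a = 1/\<alpha>\<close>, \<open>b = 1/\<beta>\<close>, \<open>u = 2\<^bsup>j/2\<^esup>\<close> and \<open>e = 1/R\<close> the left-hand side is \<open>2\<^bsup>2j\<^esup>\<close> times the factor of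
  the upper bound for the averaged sum. What matters is that the excess over \<open>ab\<close> has a factor \<open>e\<close> and
  grows no faster than \<open>u\<^sup>4 = 2\<^bsup>2j\<^esup>\<close>.\<close>

lemma covolume_error_bound:
  fixes a b u e :: real
  assumes "a > 0" "b > 0" "u > 0" "e \<ge> 0" "e \<le> 1"
  shows "(a + u * e) * (b + u * e) * (1 + u\<^sup>2 * e) \<le> a * b + e * (a * b + 2 * (a + b) + 2) * (1 + u ^ 4)"
proof -
  have *: "e * y \<le> y" if "y \<ge> 0" for y :: real
    using mult_right_mono[OF assms(5) that] by simp
  have p: "u \<le> 1 + u ^ 4" "u\<^sup>2 \<le> 1 + u ^ 4" "u ^ 3 \<le> 1 + u ^ 4"
  proof -
    \<comment> \<open>Powers up to the fourth are at most \<open>1\<close> for \<open>u \<le> 1\<close> and at most \<open>u\<^sup>4\<close> otherwise.\<close>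
    have "u ^ k \<le> 1 + u ^ 4" if "k \<le> 4" for k
    proof (cases "u \<le> 1")
      case True
      then have "u ^ k \<le> 1" using assms by (simp add: power_le_one)
      then show ?thesis using assms by (simp add: add_increasing2)
    next
      case False
      then have "u ^ k \<le> u ^ 4" using that by (intro power_increasing) auto
      then show ?thesis by simp
    qed
    from this[of 1] this[of 2] this[of 3] show "u \<le> 1 + u ^ 4" "u\<^sup>2 \<le> 1 + u ^ 4" "u ^ 3 \<le> 1 + u ^ 4" by auto
  qed
  have 1: "e * u ^ 3 \<le> u ^ 3" "e * u ^ 4 \<le> u ^ 4" using * assms by auto
  have "(a + u * e) * (b + u * e) * (1 + u\<^sup>2 * e) =
     a * b + e * (a * b * u\<^sup>2 + (a + b) * (u + e * u ^ 3) + e * (u\<^sup>2 + e * u ^ 4))"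
    by (simp add: algebra_simps power2_eq_square power3_eq_cube power4_eq_xxxx)
  also have "\<dots> \<le> a * b + e * (a * b * (1 + u ^ 4) + (a + b) * ((1 + u ^ 4) + (1 + u ^ 4)) + ((1 + u ^ 4) + (1 + u ^ 4)))"
  proof (intro add_left_mono mult_left_mono add_mono)
    have "e * (u\<^sup>2 + e * u ^ 4) \<le> u\<^sup>2 + e * u ^ 4" using assms by (intro *) auto
    also have "\<dots> \<le> (1 + u ^ 4) + (1 + u ^ 4)" using 1 p by linarith
    finally show "e * (u\<^sup>2 + e * u ^ 4) \<le> (1 + u ^ 4) + (1 + u ^ 4)" .
    show "e * u ^ 3 \<le> 1 + u ^ 4" using 1 p by linarith
  qed (use assms p in auto)
  also have "\<dots> = a * b + e * (a * b + 2 * (a + b) + 2) * (1 + u ^ 4)"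
    by (simp add: algebra_simps)
  finally show ?thesis .
qed

lemma abs_mult_inverse_square:
  "ennreal \<bar>x\<bar> * ennreal ((1 / \<bar>x\<bar>)\<^sup>2) = ennreal (1 / \<bar>x\<bar>)"
proof -
  have "y * (1 / y)\<^sup>2 = 1 / y" for y :: real
    by (cases "y = 0") (simp_all add: power2_eq_square)
  then show ?thesis by (simp add: ennreal_mult[symmetric])
qed

text \<open>The sign \<open>s\<close> selects the half-line \<open>s x > 0\<close>.\<close>

locale wavelet_frame =
  fixes \<alpha> \<beta> A B s :: real and g :: "real \<times> real \<Rightarrow> complex"
  assumes \<alpha>: "\<alpha> > 0" and \<beta>: "\<beta> > 0" and g: "g \<in> L2 LamR"
    and frame: "L2_frame LamR (Uhat_index \<alpha> \<beta> 1) (Uhat g) A B"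
    and s: "s = 1 \<or> s = -1"
begin

text \<open>A Borel function on the whole plane that agrees with \<open>g\<close> off the line \<open>x = 0\<close>, where \<open>g\<close> may be
  non-measurable.\<close>

definition g0 :: "real \<times> real \<Rightarrow> complex" where
  "g0 z = indicator (Lam \<times> UNIV) z *\<^sub>R g z"

lemma g0_eq: "x \<noteq> 0 \<Longrightarrow> g0 (x, t) = g (x, t)"
  by (simp add: g0_def Lam_def)

lemma g0_measurable [measurable]: "g0 \<in> borel_measurable (borel \<Otimes>\<^sub>M borel)"
  using g unfolding L2_def borel_measurable_LamR_iff g0_def[abs_def] borel_prod by auto

definition \<gamma> :: "real \<Rightarrow> ennreal" where
  "\<gamma> x = (\<integral>\<^sup>+t. ennreal ((cmod (g0 (x, t)))\<^sup>2) \<partial>lborel)"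

lemma \<gamma>_measurable [measurable]: "\<gamma> \<in> borel_measurable borel"
proof -
  have "\<gamma> \<in> borel_measurable lborel" unfolding \<gamma>_def by measurable
  then show ?thesis by simp
qed

lemma weighted_\<gamma>_finite: "(\<integral>\<^sup>+x. ennreal \<bar>x\<bar> * \<gamma> x \<partial>lborel) < \<infinity>"
proof -
  have m: "(\<lambda>z. ennreal ((cmod (g0 z))\<^sup>2)) \<in> borel_measurable borel"
    using g0_measurable unfolding borel_prod by measurable
  have "integrable LamR (\<lambda>z. (cmod (g z))\<^sup>2)" using g by (simp add: L2_def)
  then have "(\<integral>\<^sup>+z. ennreal (norm ((cmod (g z))\<^sup>2)) \<partial>LamR) < \<infinity>"
    unfolding integrable_iff_bounded by auto
  also have "(\<integral>\<^sup>+z. ennreal (norm ((cmod (g z))\<^sup>2)) \<partial>LamR) = (\<integral>\<^sup>+z. ennreal ((cmod (g0 z))\<^sup>2) \<partial>LamR)"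
    by (intro nn_integral_cong) (auto simp: space_LamR g0_def)
  also have "\<dots> = (\<integral>\<^sup>+x. \<integral>\<^sup>+t. ennreal \<bar>x\<bar> * ennreal ((cmod (g0 (x, t)))\<^sup>2) \<partial>lborel \<partial>lborel)"
    by (rule nn_integral_LamR[OF m])
  also have "\<dots> = (\<integral>\<^sup>+x. ennreal \<bar>x\<bar> * \<gamma> x \<partial>lborel)"
    unfolding \<gamma>_def by (intro nn_integral_cong nn_integral_cmult) measurable
  finally show ?thesis .
qed

text \<open>The test function: its fibre norms are \<open>1/\<bar>x\<bar>\<close> on one octave, which makes \<open>dx/\<bar>x\<bar>\<close> appear in
  \<open>nn_integral_\<Phi>\<close>.\<close>

definition f :: "real \<times> real \<Rightarrow> complex" where
  "f = (\<lambda>(x, t). complex_of_real (indicator {1..<2} (s * x) * indicator {0..1} t / \<bar>x\<bar>))"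

lemma f_measurable [measurable]: "f \<in> borel_measurable (borel \<Otimes>\<^sub>M borel)"
  unfolding f_def by measurable

lemma abs_s: "1 \<le> s * x \<Longrightarrow> \<bar>x\<bar> = s * x"
  using s by auto

lemma cmod_f_square: "(cmod (f (x, t)))\<^sup>2 = indicator {1..<2} (s * x) * (1 / \<bar>x\<bar>)\<^sup>2 * indicator {0..1} t"
  by (simp add: f_def norm_mult norm_divide power_mult_distrib indicator_def power2_eq_square)

lemma nn_integral_f_square:
  "(\<integral>\<^sup>+t. ennreal ((cmod (f (x, t)))\<^sup>2) \<partial>lborel) = indicator {1..<2} (s * x) * ennreal ((1 / \<bar>x\<bar>)\<^sup>2)"
proof -
  have "(\<integral>\<^sup>+t. ennreal ((cmod (f (x, t)))\<^sup>2) \<partial>lborel) =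
     (\<integral>\<^sup>+t. ennreal (indicator {1..<2} (s * x) * (1 / \<bar>x\<bar>)\<^sup>2) * indicator {0..1::real} t \<partial>lborel)"
    unfolding cmod_f_square by (intro nn_integral_cong) (auto simp: indicator_def)
  also have "\<dots> = ennreal (indicator {1..<2} (s * x) * (1 / \<bar>x\<bar>)\<^sup>2)"
    by (subst nn_integral_cmult_indicator) auto
  finally show ?thesis by (auto simp: indicator_def)
qed

lemma Dhat_measurable [measurable]: "Dhat j g0 \<in> borel_measurable (borel \<Otimes>\<^sub>M borel)"
  unfolding Dhat_def by measurable

lemma nn_integral_Dhat_square:
  "(\<integral>\<^sup>+t. ennreal ((cmod (Dhat j g0 (x, t)))\<^sup>2) \<partial>lborel) = ennreal (2 powr (2 * of_int j)) * \<gamma> (2 powr (of_int j) * x)"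
proof -
  have "\<gamma> (2 powr (of_int j) * x) = ennreal \<bar>2 powr (- of_int j / 2)\<bar> *
      (\<integral>\<^sup>+t. ennreal ((cmod (g0 (2 powr (of_int j) * x, 0 + 2 powr (- of_int j / 2) * t)))\<^sup>2) \<partial>lborel)"
    unfolding \<gamma>_def by (rule nn_integral_real_affine) simp_all
  then have "ennreal (2 powr (2 * of_int j)) * \<gamma> (2 powr (of_int j) * x) =
     ennreal ((2 powr (3 * of_int j / 4))\<^sup>2) * (\<integral>\<^sup>+t. ennreal ((cmod (g0 (2 powr (of_int j) * x, 2 powr (- of_int j / 2) * t)))\<^sup>2) \<partial>lborel)"
    by (simp add: mult.assoc[symmetric] ennreal_mult[symmetric] power2_eq_square flip: powr_add)
  also have "\<dots> = (\<integral>\<^sup>+t. ennreal ((2 powr (3 * of_int j / 4))\<^sup>2) * ennreal ((cmod (g0 (2 powr (of_int j) * x, 2 powr (- of_int j / 2) * t)))\<^sup>2) \<partial>lborel)"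
    by (rule nn_integral_cmult[symmetric]) measurable
  also have "\<dots> = (\<integral>\<^sup>+t. ennreal ((cmod (Dhat j g0 (x, t)))\<^sup>2) \<partial>lborel)"
    by (intro nn_integral_cong)
       (simp add: Dhat_def norm_mult power_mult_distrib ennreal_mult powr_real_of_int'[symmetric])
  finally show ?thesis ..
qed

text \<open>Unitarity of the dilation, as far as finiteness is concerned.\<close>

lemma weighted_Dhat_finite:
  "(\<integral>\<^sup>+x. ennreal \<bar>x\<bar> * (ennreal (2 powr (2 * of_int j)) * \<gamma> (2 powr (of_int j) * x)) \<partial>lborel) < \<infinity>"
proof -
  have "(\<integral>\<^sup>+x. ennreal \<bar>x\<bar> * \<gamma> x \<partial>lborel) =
     ennreal \<bar>2 powr (of_int j)\<bar> * (\<integral>\<^sup>+x. ennreal \<bar>0 + 2 powr (of_int j) * x\<bar> * \<gamma> (0 + 2 powr (of_int j) * x) \<partial>lborel)"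
    by (rule nn_integral_real_affine) simp_all
  also have "\<dots> = (\<integral>\<^sup>+x. ennreal \<bar>2 powr (of_int j)\<bar> * (ennreal \<bar>0 + 2 powr (of_int j) * x\<bar> * \<gamma> (0 + 2 powr (of_int j) * x)) \<partial>lborel)"
    by (rule nn_integral_cmult[symmetric]) measurable
  also have "\<dots> = (\<integral>\<^sup>+x. ennreal \<bar>x\<bar> * (ennreal (2 powr (2 * of_int j)) * \<gamma> (2 powr (of_int j) * x)) \<partial>lborel)"
  proof (rule nn_integral_cong)
    fix x :: real
    have "ennreal \<bar>2 powr (of_int j)\<bar> * ennreal \<bar>0 + 2 powr (of_int j) * x\<bar> = ennreal \<bar>x\<bar> * ennreal (2 powr (2 * of_int j))"
    proof -
      have "2 powr (2 * of_int j :: real) = 2 powr (of_int j) * 2 powr (of_int j)"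
        by (simp flip: powr_add)
      then show ?thesis
        by (simp add: ennreal_mult[symmetric] abs_mult)
    qed
    then show "ennreal \<bar>2 powr (of_int j)\<bar> * (ennreal \<bar>0 + 2 powr (of_int j) * x\<bar> * \<gamma> (0 + 2 powr (of_int j) * x)) =
       ennreal \<bar>x\<bar> * (ennreal (2 powr (2 * of_int j)) * \<gamma> (2 powr (of_int j) * x))"
      by (simp only: mult.assoc[symmetric] add_0)
  qed
  finally show ?thesis using weighted_\<gamma>_finite by simp
qed

sublocale orth: heisenberg_orthogonality f "Dhat j g0" 1 for j
proof
  show "cmod (f z) \<le> 1" for z
    using abs_s[of "fst z"] by (cases z) (auto simp: f_def indicator_def norm_mult norm_divide)
  show "1 \<le> \<bar>x\<bar> \<and> \<bar>x\<bar> \<le> 2 \<and> 0 \<le> t \<and> t \<le> 1" if "f (x, t) \<noteq> 0" for x t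
    using that abs_s[of x] by (auto simp: f_def indicator_def split: if_splits)
  have "(\<integral>\<^sup>+x. \<integral>\<^sup>+t. ennreal (\<bar>x\<bar> * (cmod (Dhat j g0 (x, t)))\<^sup>2) \<partial>lborel \<partial>lborel) =
     (\<integral>\<^sup>+x. ennreal \<bar>x\<bar> * (\<integral>\<^sup>+t. ennreal ((cmod (Dhat j g0 (x, t)))\<^sup>2) \<partial>lborel) \<partial>lborel)"
    by (simp add: ennreal_mult nn_integral_cmult)
  then show "(\<integral>\<^sup>+x. \<integral>\<^sup>+t. ennreal (\<bar>x\<bar> * (cmod (Dhat j g0 (x, t)))\<^sup>2) \<partial>lborel \<partial>lborel) < \<infinity>"
    unfolding nn_integral_Dhat_square using weighted_Dhat_finite by simp
qed measurable

definition \<Phi> :: "int \<Rightarrow> real \<Rightarrow> real \<Rightarrow> real \<Rightarrow> ennreal" where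
  "\<Phi> j p q r = ennreal ((cmod (coeff (That p q r f) (Dhat j g0)))\<^sup>2)"

text \<open>The contribution of the scale \<open>j\<close> to the integral in the theorem, pulled back to the basic octave.\<close>

definition octave_mass :: "int \<Rightarrow> ennreal" where
  "octave_mass j = (\<integral>\<^sup>+x. indicator {1..<2} (s * x) * ennreal (1 / \<bar>x\<bar>) * \<gamma> (2 powr (of_int j) * x) \<partial>lborel)"

text \<open>The factor \<open>2\<^bsup>2j\<^esup>\<close> that dilation puts on the squared fibre norms is the one that the volume
  \<open>2\<^bsup>2j\<^esup>\<alpha>\<beta>\<close> of the lattice cells cancels.\<close>

lemma nn_integral_\<Phi>:
  "(\<integral>\<^sup>+p. \<integral>\<^sup>+q. \<integral>\<^sup>+r. \<Phi> j p q r \<partial>lborel \<partial>lborel \<partial>lborel) = ennreal (2 powr (2 * of_int j)) * octave_mass j"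
proof -
  have "(\<integral>\<^sup>+p. \<integral>\<^sup>+q. \<integral>\<^sup>+r. \<Phi> j p q r \<partial>lborel \<partial>lborel \<partial>lborel) =
     (\<integral>\<^sup>+x. ennreal \<bar>x\<bar> * (indicator {1..<2} (s * x) * ennreal ((1 / \<bar>x\<bar>)\<^sup>2) * (ennreal (2 powr (2 * of_int j)) * \<gamma> (2 powr (of_int j) * x))) \<partial>lborel)"
    unfolding \<Phi>_def orth.orthogonality orth.Nf_def orth.Ng_def nn_integral_f_square nn_integral_Dhat_square ..
  also have "\<dots> = (\<integral>\<^sup>+x. ennreal (2 powr (2 * of_int j)) * (indicator {1..<2} (s * x) * ennreal (1 / \<bar>x\<bar>) * \<gamma> (2 powr (of_int j) * x)) \<partial>lborel)"
  proof (rule nn_integral_cong)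
    fix x :: real
    show "ennreal \<bar>x\<bar> * (indicator {1..<2} (s * x) * ennreal ((1 / \<bar>x\<bar>)\<^sup>2) * (ennreal (2 powr (2 * of_int j)) * \<gamma> (2 powr (of_int j) * x))) = 
      ennreal (2 powr (2 * of_int j)) * (indicator {1..<2} (s * x) * ennreal (1 / \<bar>x\<bar>) * \<gamma> (2 powr (of_int j) * x))"
      unfolding abs_mult_inverse_square[symmetric] by (simp only: mult_ac)
  qed
  also have "\<dots> = ennreal (2 powr (2 * of_int j)) * octave_mass j"
    unfolding octave_mass_def by (rule nn_integral_cmult) measurable
  finally show ?thesis .
qed

text \<open>Rewriting the coefficient as a Fourier transform shows the joint measurability.\<close>

lemma \<Phi>_measurable: "(\<lambda>(p, q, r). \<Phi> j p q r) \<in> borel_measurable borel"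
proof -
  have [measurable]: "(fst :: real \<times> real \<times> real \<Rightarrow> real) \<in> borel_measurable borel"
      "(\<lambda>z :: real \<times> real \<times> real. fst (snd z)) \<in> borel_measurable borel"
      "(\<lambda>z :: real \<times> real \<times> real. snd (snd z)) \<in> borel_measurable borel"
    by (intro borel_measurable_continuous_onI continuous_intros)+
  show ?thesis
    unfolding \<Phi>_def split_beta' orth.coeff_eq_fourier fourier_def by measurable
qed

lemma coeff_lattice:
  "ennreal ((cmod (L2_inner LamR (That p q r f) (Uhat g (j, \<alpha> * of_int a, \<beta> * of_int b, of_int c))))\<^sup>2) =
   \<Phi> j (p - 2 powr (of_int j / 2) * \<alpha> * of_int a) (q - 2 powr (of_int j / 2) * \<beta> * of_int b)
     (r - 2 powr (of_int j) * of_int c - (q - 2 powr (of_int j / 2) * \<beta> * of_int b) * (2 powr (of_int j / 2) * \<alpha> * of_int a))"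
proof -
  let ?i = "(j, \<alpha> * of_int a, \<beta> * of_int b, of_int c) :: int \<times> real \<times> real \<times> real"
  let ?F = "That p q r f"
  have "Uhat g ?i z = Uhat g0 ?i z" if "z \<in> space LamR" for z
    using that by (cases z) (auto simp: space_LamR Lam_def Uhat_def Dhat_def That_cis g0_eq)
  then have "L2_inner LamR ?F (Uhat g ?i) = (LINT z|LamR. ?F z * cnj (Uhat g0 ?i z))"
    unfolding L2_inner_def by (intro Bochner_Integration.integral_cong) auto
  also have "\<dots> = coeff ?F (Uhat g0 ?i)"
  proof -
    have "(\<lambda>z. ?F z * cnj (Uhat g0 ?i z)) \<in> borel_measurable (borel \<Otimes>\<^sub>M borel)"
      unfolding Uhat_eq_That by measurable
    then have "(\<lambda>z. ?F z * cnj (Uhat g0 ?i z)) \<in> borel_measurable borel"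
      unfolding borel_prod .
    then show ?thesis unfolding coeff_def by (rule integral_LamR)
  qed
  finally show ?thesis
    unfolding \<Phi>_def Uhat_eq_That by (simp add: coeff_That mult.assoc)
qed

lemma nn_integral_test_function:
  "(\<integral>\<^sup>+z. ennreal ((cmod (That p q r f z))\<^sup>2) \<partial>LamR) = ennreal (ln 2)"
proof -
  have "(\<lambda>z. ennreal ((cmod (That p q r f z))\<^sup>2)) \<in> borel_measurable (borel \<Otimes>\<^sub>M borel)"
    by measurable
  then have "(\<integral>\<^sup>+z. ennreal ((cmod (That p q r f z))\<^sup>2) \<partial>LamR) =
     (\<integral>\<^sup>+x. \<integral>\<^sup>+t. ennreal \<bar>x\<bar> * ennreal ((cmod (That p q r f (x, t)))\<^sup>2) \<partial>lborel \<partial>lborel)"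
    unfolding borel_prod by (rule nn_integral_LamR)
  also have "\<dots> = (\<integral>\<^sup>+x. \<integral>\<^sup>+t. ennreal \<bar>x\<bar> * ennreal ((cmod (f (x, t - p)))\<^sup>2) \<partial>lborel \<partial>lborel)"
    by (simp add: That_cis norm_mult)
  also have "\<dots> = (\<integral>\<^sup>+x. ennreal \<bar>x\<bar> * (\<integral>\<^sup>+t. ennreal ((cmod (f (x, t - p)))\<^sup>2) \<partial>lborel) \<partial>lborel)"
    by (intro nn_integral_cong nn_integral_cmult) measurable
  also have "\<dots> = (\<integral>\<^sup>+x. ennreal \<bar>x\<bar> * (indicator {1..<2} (s * x) * ennreal ((1 / \<bar>x\<bar>)\<^sup>2)) \<partial>lborel)"
    unfolding orth.Nf_translate orth.Nf_def nn_integral_f_square ..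
  also have "\<dots> = (\<integral>\<^sup>+x. ennreal (1 / (s * x)) * indicator {1..<2} (0 + s * x) \<partial>lborel)"
  proof (rule nn_integral_cong)
    fix x :: real
    show "ennreal \<bar>x\<bar> * (indicator {1..<2} (s * x) * ennreal ((1 / \<bar>x\<bar>)\<^sup>2)) = ennreal (1 / (s * x)) * indicator {1..<2} (0 + s * x)"
      using abs_s[of x] abs_mult_inverse_square[of x] by (auto simp: indicator_def)
  qed
  also have "\<dots> = (\<integral>\<^sup>+x. ennreal (1 / x) * indicator {1..<2} x \<partial>lborel)"
    using nn_integral_real_affine[of "\<lambda>x. ennreal (1 / x) * indicator {1..<2} x" s 0] s by auto
  finally show ?thesis unfolding nn_integral_inverse_octave .
qed

lemma test_function_L2: "That p q r f \<in> L2 LamR" "(L2_norm LamR (That p q r f))\<^sup>2 = ln 2"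
proof -
  have m: "That p q r f \<in> borel_measurable borel"
    using That_measurable[OF f_measurable] unfolding borel_prod .
  have m': "That p q r f \<in> borel_measurable LamR"
    unfolding borel_measurable_LamR_iff using m by measurable
  have I: "integrable LamR (\<lambda>z. (cmod (That p q r f z))\<^sup>2)"
    using m' by (intro integrableI_bounded) (auto simp: nn_integral_test_function)
  show "That p q r f \<in> L2 LamR" using I m' by (simp add: L2_def)
  have "ennreal (LINT z|LamR. (cmod (That p q r f z))\<^sup>2) = ennreal (ln 2)"
    using I by (subst nn_integral_eq_integral[symmetric]) (auto simp: nn_integral_test_function)
  then have "(LINT z|LamR. (cmod (That p q r f z))\<^sup>2) = ln 2"
    by (subst (asm) ennreal_inj) auto
  then show "(L2_norm LamR (That p q r f))\<^sup>2 = ln 2"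
    by (simp add: L2_norm_def)
qed

abbreviation shift_step :: "int \<Rightarrow> real" where "shift_step j \<equiv> 2 powr (of_int j / 2) * \<alpha>"
abbreviation freq_step :: "int \<Rightarrow> real" where "freq_step j \<equiv> 2 powr (of_int j / 2) * \<beta>"
abbreviation mod_step :: "int \<Rightarrow> real" where "mod_step j \<equiv> 2 powr (of_int j)"

definition mean :: "real \<Rightarrow> int \<Rightarrow> ennreal" where
  "mean R j = heisenberg_periodization.mean (\<Phi> j) (shift_step j) (freq_step j) (mod_step j) R"

lemma periodization: "R > 0 \<Longrightarrow> heisenberg_periodization (\<Phi> j) (shift_step j) (freq_step j) (mod_step j) R"
  using \<alpha> \<beta> by unfold_locales (auto simp: \<Phi>_measurable)

text \<open>The frame inequality for one moved test function, whose squared norm is always \<open>ln 2\<close>.\<close>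

lemma frame_sum:
  fixes p q r :: real
  defines "S \<equiv> (\<Sum>\<^sub>\<int> j. \<Sum>\<^sub>\<int> a. \<Sum>\<^sub>\<int> b. \<Sum>\<^sub>\<int> c.
     \<Phi> j (p - shift_step j * of_int a) (q - freq_step j * of_int b)
     (r - mod_step j * of_int c - (q - freq_step j * of_int b) * (shift_step j * of_int a)))"
  shows "ennreal (A * ln 2) \<le> S" and "S \<le> ennreal (B * ln 2)"
proof -
  let ?F = "That p q r f" and ?I = "Uhat_index \<alpha> \<beta> 1"
  let ?c = "\<lambda>i. (cmod (L2_inner LamR ?F (Uhat g i)))\<^sup>2"
  have fr: "?c summable_on ?I" "A * ln 2 \<le> infsum ?c ?I" "infsum ?c ?I \<le> B * ln 2"
    using frame test_function_L2[of p q r] unfolding L2_frame_def by auto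
  have "S = (\<integral>\<^sup>+i. ennreal (?c i) \<partial>count_space ?I)"
    unfolding S_def nn_integral_Uhat_index[OF \<alpha> \<beta>] coeff_lattice ..
  also have "\<dots> = ennreal (infsum ?c ?I)"
    by (rule infsum_eq_nn_integral_count_space[OF fr(1)]) simp
  finally have S: "S = ennreal (infsum ?c ?I)" .
  show "ennreal (A * ln 2) \<le> S" "S \<le> ennreal (B * ln 2)"
    unfolding S using fr by (auto intro: ennreal_leI)
qed

lemma frame_mean:
  assumes R: "R > 0"
  shows "ennreal (A * ln 2) \<le> (\<Sum>\<^sub>\<int> j. mean R j)" and "(\<Sum>\<^sub>\<int> j. mean R j) \<le> ennreal (B * ln 2)"
proof -
  let ?U = "interval_avg R"
  interpret U: prob_space ?U using R by (rule prob_space_interval_avg)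
  interpret per: heisenberg_periodization "\<Phi> j" "shift_step j" "freq_step j" "mod_step j" R for j
    using R by (rule periodization)
  have one: "emeasure lborel {0..<R} / emeasure lborel {0..<R} = 1"
    using R by (simp add: ennreal_divide_self)
  let ?S = "\<lambda>p q r. \<Sum>\<^sub>\<int> j. per.periodized j p q r"
  have swap: "(\<Sum>\<^sub>\<int> j. mean R j) = (\<integral>\<^sup>+p. \<integral>\<^sup>+q. \<integral>\<^sup>+r. ?S p q r \<partial>?U \<partial>?U \<partial>?U)"
    unfolding mean_def per.mean_def by (simp add: nn_integral_int_sum)
  have b: "ennreal (A * ln 2) \<le> ?S p q r" "?S p q r \<le> ennreal (B * ln 2)" for p q r
    using frame_sum[of p q r] unfolding per.periodized_def by auto
  have "(\<integral>\<^sup>+p. \<integral>\<^sup>+q. \<integral>\<^sup>+r. ennreal (A * ln 2) \<partial>?U \<partial>?U \<partial>?U) \<le> (\<Sum>\<^sub>\<int> j. mean R j)"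
    unfolding swap by (intro nn_integral_mono b)
  then show "ennreal (A * ln 2) \<le> (\<Sum>\<^sub>\<int> j. mean R j)"
    by (simp add: one)
  have "(\<Sum>\<^sub>\<int> j. mean R j) \<le> (\<integral>\<^sup>+p. \<integral>\<^sup>+q. \<integral>\<^sup>+r. ennreal (B * ln 2) \<partial>?U \<partial>?U \<partial>?U)"
    unfolding swap by (intro nn_integral_mono b)
  then show "(\<Sum>\<^sub>\<int> j. mean R j) \<le> ennreal (B * ln 2)"
    by (simp add: one)
qed

end

section \<open>The limit of large averaging boxes\<close>

lemma ennreal_le_of_vanishing_error:
  fixes X Y Z :: ennreal
  assumes "Z < \<infinity>" and le: "\<And>n::nat. X \<le> Y + ennreal (K / real (Suc n)) * Z"
  shows "X \<le> Y"
proof -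
  obtain z where z: "Z = ennreal z" "z \<ge> 0" using assms(1) by (cases Z) auto
  have "(\<lambda>n. K / real (Suc n) * z) \<longlonglongrightarrow> 0" by real_asymp
  then have "(\<lambda>n. ennreal (K / real (Suc n) * z)) \<longlonglongrightarrow> ennreal 0"
    by (rule tendsto_ennrealI)
  then have "(\<lambda>n. Y + ennreal (K / real (Suc n) * z)) \<longlonglongrightarrow> Y + ennreal 0"
    by (intro tendsto_add tendsto_const)
  moreover have "ennreal (K / real (Suc n) * z) = ennreal (K / real (Suc n)) * Z" for n
    unfolding z(1) using z(2) by (simp only: ennreal_mult'')
  ultimately show ?thesis
    using le by (intro LIMSEQ_le_const[of "\<lambda>n. Y + ennreal (K / real (Suc n)) * Z" Y X]) auto
qed

context wavelet_frame
begin

text \<open>The measure \<open>dx/\<bar>x\<bar>\<close> is invariant under dilations, so only the indicator of the octave changes.\<close>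

lemma octave_mass_dilated:
  "octave_mass j = (\<integral>\<^sup>+y. ennreal (1 / \<bar>y\<bar>) * \<gamma> y * indicator {1..<2} (2 powr (- of_int j) * (s * y)) \<partial>lborel)"
proof -
  let ?c = "2 powr (- of_int j) :: real"
  let ?F = "\<lambda>x. indicator {1..<2} (s * x) * ennreal (1 / \<bar>x\<bar>) * \<gamma> (2 powr (of_int j) * x)"
  have "octave_mass j = ennreal \<bar>?c\<bar> * (\<integral>\<^sup>+y. ?F (0 + ?c * y) \<partial>lborel)"
    unfolding octave_mass_def by (rule nn_integral_real_affine) simp_all
  also have "\<dots> = (\<integral>\<^sup>+y. ennreal \<bar>?c\<bar> * ?F (0 + ?c * y) \<partial>lborel)"
    by (rule nn_integral_cmult[symmetric]) measurable
  also have "\<dots> = (\<integral>\<^sup>+y. ennreal (1 / \<bar>y\<bar>) * \<gamma> y * indicator {1..<2} (?c * (s * y)) \<partial>lborel)"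
  proof (rule nn_integral_cong)
    fix y :: real
    have 1: "ennreal \<bar>?c\<bar> * ennreal (1 / \<bar>?c * y\<bar>) = ennreal (1 / \<bar>y\<bar>)"
      by (simp add: ennreal_mult[symmetric] abs_mult)
    have 2: "2 powr (of_int j) * (?c * y) = y"
      by (simp add: mult.assoc[symmetric] flip: powr_add)
    have 3: "s * (?c * y) = ?c * (s * y)" by simp
    have "a * (i * b * d) = a * b * d * i" for a b d i :: ennreal
      by (simp only: mult_ac)
    then show "ennreal \<bar>?c\<bar> * ?F (0 + ?c * y) = ennreal (1 / \<bar>y\<bar>) * \<gamma> y * indicator {1..<2} (?c * (s * y))"
      unfolding add_0 2 3 by (simp only: 1)
  qed
  finally show ?thesis .
qed

lemma sum_octave_mass: "int_sum octave_mass = (\<integral>\<^sup>+y. ennreal (1 / \<bar>y\<bar>) * \<gamma> y * indicator {0<..} (s * y) \<partial>lborel)"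
proof -
  have "int_sum octave_mass = (\<Sum>\<^sub>\<int> j. \<integral>\<^sup>+y. ennreal (1 / \<bar>y\<bar>) * \<gamma> y * indicator {1..<2} (2 powr (- of_int j) * (s * y)) \<partial>lborel)"
    by (simp add: octave_mass_dilated[abs_def])
  also have "\<dots> = (\<integral>\<^sup>+y. (\<Sum>\<^sub>\<int> j. ennreal (1 / \<bar>y\<bar>) * \<gamma> y * indicator {1..<2} (2 powr (- of_int j) * (s * y))) \<partial>lborel)"
    by (rule nn_integral_int_sum[symmetric]) measurable
  finally show ?thesis unfolding int_sum_cmult sum_dyadic_indicator .
qed

text \<open>On the \<open>j\<close>-th dilate of the octave \<open>2\<^sup>j \<le> \<bar>y\<bar>\<close>, whence \<open>2\<^bsup>2j\<^esup>/\<bar>y\<bar> \<le> \<bar>y\<bar>\<close>, and \<open>\<integral> \<bar>y\<bar> \<gamma>(y) dy\<close> is the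
  squared norm of \<open>g\<close>.\<close>

lemma sum_weighted_octave_mass_finite: "(\<Sum>\<^sub>\<int> j. ennreal (2 powr (2 * of_int j)) * octave_mass j) < \<infinity>"
proof -
  have "ennreal (2 powr (2 * of_int j)) * octave_mass j \<le>
     (\<integral>\<^sup>+y. ennreal \<bar>y\<bar> * \<gamma> y * indicator {1..<2} (2 powr (- of_int j) * (s * y)) \<partial>lborel)" for j
  proof -
    have "ennreal (2 powr (2 * of_int j)) * octave_mass j =
      (\<integral>\<^sup>+y. ennreal (2 powr (2 * of_int j)) * (ennreal (1 / \<bar>y\<bar>) * \<gamma> y * indicator {1..<2} (2 powr (- of_int j) * (s * y))) \<partial>lborel)"
      unfolding octave_mass_dilated by (rule nn_integral_cmult[symmetric]) measurable
    also have "\<dots> \<le> (\<integral>\<^sup>+y. ennreal \<bar>y\<bar> * \<gamma> y * indicator {1..<2} (2 powr (- of_int j) * (s * y)) \<partial>lborel)"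
    proof (rule nn_integral_mono)
      fix y :: real
      show "ennreal (2 powr (2 * of_int j)) * (ennreal (1 / \<bar>y\<bar>) * \<gamma> y * indicator {1..<2} (2 powr (- of_int j) * (s * y)))
         \<le> ennreal \<bar>y\<bar> * \<gamma> y * indicator {1..<2} (2 powr (- of_int j) * (s * y))"
      proof (cases "1 \<le> 2 powr (- of_int j) * (s * y)")
        case True
        let ?d = "2 powr (of_int j) :: real"
        have d: "?d \<le> s * y"
          using True by (simp add: powr_minus field_simps)
        moreover have "0 < ?d" by simp
        ultimately have sy: "s * y > 0" by linarith
        then have abs: "\<bar>y\<bar> = s * y" using s by auto
        have "2 powr (2 * of_int j) = ?d * ?d" by (simp flip: powr_add)
        also have "\<dots> \<le> \<bar>y\<bar> * \<bar>y\<bar>"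
          unfolding abs using d sy by (intro mult_mono) auto
        finally have "2 powr (2 * of_int j) * (1 / \<bar>y\<bar>) \<le> \<bar>y\<bar>"
          using sy abs by (simp add: field_simps)
        then have "ennreal (2 powr (2 * of_int j)) * ennreal (1 / \<bar>y\<bar>) \<le> ennreal \<bar>y\<bar>"
          by (simp only: ennreal_mult[symmetric] powr_ge_zero zero_le_divide_1_iff abs_ge_zero ennreal_leI)
        then show ?thesis
          unfolding mult.assoc[symmetric] by (intro mult_right_mono) auto
      qed simp
    qed
    finally show ?thesis .
  qed
  then have "(\<Sum>\<^sub>\<int> j. ennreal (2 powr (2 * of_int j)) * octave_mass j) \<le>
     (\<Sum>\<^sub>\<int> j. \<integral>\<^sup>+y. ennreal \<bar>y\<bar> * \<gamma> y * indicator {1..<2} (2 powr (- of_int j) * (s * y)) \<partial>lborel)"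
    by (rule int_sum_mono)
  also have "\<dots> = (\<integral>\<^sup>+y. (\<Sum>\<^sub>\<int> j. ennreal \<bar>y\<bar> * \<gamma> y * indicator {1..<2} (2 powr (- of_int j) * (s * y))) \<partial>lborel)"
    by (rule nn_integral_int_sum[symmetric]) measurable
  also have "\<dots> = (\<integral>\<^sup>+y. ennreal \<bar>y\<bar> * \<gamma> y * indicator {0<..} (s * y) \<partial>lborel)"
    unfolding int_sum_cmult sum_dyadic_indicator ..
  also have "\<dots> \<le> (\<integral>\<^sup>+y. ennreal \<bar>y\<bar> * \<gamma> y \<partial>lborel)"
    by (intro nn_integral_mono) (auto simp: indicator_def)
  also have "\<dots> < \<infinity>" by (rule weighted_\<gamma>_finite)
  finally show ?thesis .
qed

lemma sqrt_step: "2 powr (of_int j) = (2 powr (of_int j / 2 :: real))\<^sup>2" "2 powr (2 * of_int j) = (2 powr (of_int j / 2 :: real)) ^ 4"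
  by (simp_all add: power2_eq_square power4_eq_xxxx flip: powr_add)

text \<open>The averages at all scales exceed their limits by amounts that are summable over \<open>j\<close> and of order
  \<open>1/R\<close>, including the large scales, where the box \<open>[0, R)\<^sup>3\<close> is smaller than a lattice cell.\<close>

lemma mean_le:
  assumes R: "R \<ge> 1"
  defines "K \<equiv> 1 / \<alpha> * (1 / \<beta>) + 2 * (1 / \<alpha> + 1 / \<beta>) + 2"
  shows "mean R j \<le> ennreal (1 / (\<alpha> * \<beta>)) * octave_mass j + ennreal (K / R) * (octave_mass j + ennreal (2 powr (2 * of_int j)) * octave_mass j)"
proof -
  let ?u = "2 powr (of_int j / 2) :: real"
  have K: "K \<ge> 0" unfolding K_def using \<alpha> \<beta> by simp
  have R0: "R > 0" using R by simp
  interpret per: heisenberg_periodization "\<Phi> j" "shift_step j" "freq_step j" "mod_step j" R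
    using R0 by (rule periodization)
  have "mean R j \<le> ennreal ((1 / shift_step j + 1 / R) * (1 / freq_step j + 1 / R) * (1 / mod_step j + 1 / R)) * (ennreal (2 powr (2 * of_int j)) * octave_mass j)"
    using per.mean_upper unfolding mean_def nn_integral_\<Phi> .
  also have "\<dots> = ennreal ((1 / \<alpha> + ?u * (1 / R)) * (1 / \<beta> + ?u * (1 / R)) * (1 + ?u\<^sup>2 * (1 / R))) * octave_mass j"
  proof -
    have "(1 / shift_step j + 1 / R) * (1 / freq_step j + 1 / R) * (1 / mod_step j + 1 / R) * 2 powr (2 * of_int j)
       = ((1 / (?u * \<alpha>) + 1 / R) * ?u) * ((1 / (?u * \<beta>) + 1 / R) * ?u) * ((1 / ?u\<^sup>2 + 1 / R) * ?u\<^sup>2)"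
      unfolding sqrt_step by (simp add: power2_eq_square power4_eq_xxxx mult_ac)
    also have "(1 / (?u * \<alpha>) + 1 / R) * ?u = 1 / \<alpha> + ?u * (1 / R)"
      using \<alpha> R0 by (simp add: distrib_right)
    also have "(1 / (?u * \<beta>) + 1 / R) * ?u = 1 / \<beta> + ?u * (1 / R)"
      using \<beta> R0 by (simp add: distrib_right)
    also have "(1 / ?u\<^sup>2 + 1 / R) * ?u\<^sup>2 = 1 + ?u\<^sup>2 * (1 / R)"
      using R0 by (simp add: distrib_right)
    finally show ?thesis
      unfolding mult.assoc[symmetric] by (subst ennreal_mult''[symmetric]) simp_all
  qed
  also have "\<dots> \<le> ennreal (1 / (\<alpha> * \<beta>) + K / R * (1 + 2 powr (2 * of_int j))) * octave_mass j"
  proof (intro mult_right_mono ennreal_leI)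
    show "(1 / \<alpha> + ?u * (1 / R)) * (1 / \<beta> + ?u * (1 / R)) * (1 + ?u\<^sup>2 * (1 / R)) \<le> 1 / (\<alpha> * \<beta>) + K / R * (1 + 2 powr (2 * of_int j))"
      using covolume_error_bound[of "1 / \<alpha>" "1 / \<beta>" ?u "1 / R"] \<alpha> \<beta> R
      by (simp add: K_def sqrt_step)
  qed simp
  also have "\<dots> = ennreal (1 / (\<alpha> * \<beta>)) * octave_mass j + ennreal (K / R) * (octave_mass j + ennreal (2 powr (2 * of_int j)) * octave_mass j)"
  proof -
    have "ennreal (a + k * (1 + w)) = ennreal a + ennreal k * (1 + ennreal w)"
      if "0 \<le> a" "0 \<le> k" "0 \<le> w" for a k w
      using that by (simp add: ennreal_plus ennreal_mult)
    from this[of "1 / (\<alpha> * \<beta>)" "K / R" "2 powr (2 * of_int j)"]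
    have "ennreal (1 / (\<alpha> * \<beta>) + K / R * (1 + 2 powr (2 * of_int j))) =
        ennreal (1 / (\<alpha> * \<beta>)) + ennreal (K / R) * (1 + ennreal (2 powr (2 * of_int j)))"
      using \<alpha> \<beta> K R0 by simp
    then show ?thesis
      by (simp only: distrib_right distrib_left mult.assoc mult_1 mult_1_right)
  qed
  finally show ?thesis .
qed

text \<open>At a fixed scale the box eventually contains many lattice cells, and the two bounds for the
  averaged sum close up.\<close>

lemma octave_mass_le_liminf_mean: "ennreal (1 / (\<alpha> * \<beta>)) * octave_mass j \<le> liminf (\<lambda>n. mean (real (Suc n)) j)"
proof -
  let ?k = "\<lambda>n. (1 / shift_step j - 1 / real (Suc n)) * (1 / freq_step j - 1 / real (Suc n)) * (1 / mod_step j - 1 / real (Suc n)) * 2 powr (2 * of_int j)"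
  let ?w = "ennreal (2 powr (2 * of_int j)) * octave_mass j"
  \<comment> \<open>A finite mass lets the limit be taken in the reals.\<close>
  have "?w < \<infinity>"
  proof -
    have "?w = (\<Sum>\<^sub>\<int> i. ?w * indicator {j} i)"
      unfolding int_sum_cmult by (simp add: int_sum_def)
    also have "\<dots> \<le> (\<Sum>\<^sub>\<int> j. ennreal (2 powr (2 * of_int j)) * octave_mass j)"
      by (intro int_sum_mono) (auto simp: indicator_def)
    finally show ?thesis using sum_weighted_octave_mass_finite by (rule le_less_trans)
  qed
  then obtain m where m: "octave_mass j = ennreal m" "m \<ge> 0"
    by (cases "octave_mass j") (auto simp: ennreal_mult_top)
  have z: "(\<lambda>n. 1 / real (Suc n)) \<longlonglongrightarrow> 0" by real_asymp
  have "?k \<longlonglongrightarrow> (1 / shift_step j - 0) * (1 / freq_step j - 0) * (1 / mod_step j - 0) * 2 powr (2 * of_int j)"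
    by (intro tendsto_intros z)
  also have "(1 / shift_step j - 0) * (1 / freq_step j - 0) * (1 / mod_step j - 0) * 2 powr (2 * of_int j) = 1 / (\<alpha> * \<beta>)"
    unfolding sqrt_step using \<alpha> \<beta> by (simp add: field_simps power2_eq_square power4_eq_xxxx)
  finally have "(\<lambda>n. ennreal (?k n * m)) \<longlonglongrightarrow> ennreal (1 / (\<alpha> * \<beta>) * m)"
    by (intro tendsto_ennrealI tendsto_mult tendsto_const)
  then have "liminf (\<lambda>n. ennreal (?k n * m)) = ennreal (1 / (\<alpha> * \<beta>) * m)"
    by (intro lim_imp_Liminf) auto
  moreover have "liminf (\<lambda>n. ennreal (?k n * m)) \<le> liminf (\<lambda>n. mean (real (Suc n)) j)"
  proof (rule Liminf_mono)
    have "filterlim (\<lambda>n. real (Suc n)) at_top sequentially" by real_asymp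
    then have "\<forall>\<^sub>F n in sequentially. max (shift_step j) (max (freq_step j) (mod_step j)) \<le> real (Suc n)"
      unfolding filterlim_at_top by (rule spec)
    then show "\<forall>\<^sub>F n in sequentially. ennreal (?k n * m) \<le> mean (real (Suc n)) j"
    proof eventually_elim
      case (elim n)
      interpret per: heisenberg_periodization "\<Phi> j" "shift_step j" "freq_step j" "mod_step j" "real (Suc n)"
        by (rule periodization) simp
      have "ennreal (?k n * m) = ennreal ((1 / shift_step j - 1 / real (Suc n)) * (1 / freq_step j - 1 / real (Suc n)) * (1 / mod_step j - 1 / real (Suc n))) * ?w"
        unfolding m using m(2) by (simp only: ennreal_mult''[symmetric] mult.assoc powr_ge_zero mult_nonneg_nonneg)
      also have "\<dots> \<le> mean (real (Suc n)) j"
        using per.mean_lower elim unfolding mean_def nn_integral_\<Phi> by simp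
      finally show ?case .
    qed
  qed
  moreover have "ennreal (1 / (\<alpha> * \<beta>)) * octave_mass j = ennreal (1 / (\<alpha> * \<beta>) * m)"
    unfolding m using m(2) by (simp only: ennreal_mult'')
  ultimately show ?thesis by simp
qed

lemma cancel_covolume: "ennreal (\<alpha> * \<beta>) * (ennreal (1 / (\<alpha> * \<beta>)) * X) = X"
proof -
  have "ennreal (\<alpha> * \<beta>) * ennreal (1 / (\<alpha> * \<beta>)) = 1"
    using \<alpha> \<beta> by (subst ennreal_mult[symmetric]) auto
  then show ?thesis by (simp add: mult.assoc[symmetric])
qed

text \<open>Fatou's lemma over the scales.\<close>

lemma sum_octave_mass_upper: "int_sum octave_mass \<le> ennreal (B * \<alpha> * \<beta> * ln 2)"
proof -
  have "ennreal (1 / (\<alpha> * \<beta>)) * int_sum octave_mass = (\<Sum>\<^sub>\<int> j. ennreal (1 / (\<alpha> * \<beta>)) * octave_mass j)"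
    by (rule int_sum_cmult[symmetric])
  also have "\<dots> \<le> (\<Sum>\<^sub>\<int> j. liminf (\<lambda>n. mean (real (Suc n)) j))"
    by (intro int_sum_mono octave_mass_le_liminf_mean)
  also have "\<dots> \<le> liminf (\<lambda>n. \<Sum>\<^sub>\<int> j. mean (real (Suc n)) j)"
    unfolding int_sum_def by (rule nn_integral_liminf) simp
  also have "\<dots> \<le> liminf (\<lambda>n. ennreal (B * ln 2))"
    by (intro Liminf_mono always_eventually allI frame_mean) simp
  also have "\<dots> = ennreal (B * ln 2)" by (simp add: Liminf_const)
  finally have "ennreal (\<alpha> * \<beta>) * (ennreal (1 / (\<alpha> * \<beta>)) * int_sum octave_mass) \<le> ennreal (\<alpha> * \<beta>) * ennreal (B * ln 2)"
    by (rule mult_left_mono) simp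
  moreover have "ennreal (\<alpha> * \<beta>) * ennreal (B * ln 2) = ennreal (B * \<alpha> * \<beta> * ln 2)"
    using \<alpha> \<beta> by (subst ennreal_mult'[symmetric]) (simp_all add: mult_ac)
  ultimately show ?thesis unfolding cancel_covolume by simp
qed

text \<open>The upper bound just proved enters: it makes the sum of the error terms finite.\<close>

lemma sum_octave_mass_lower: "ennreal (A * \<alpha> * \<beta> * ln 2) \<le> int_sum octave_mass"
proof -
  let ?K = "1 / \<alpha> * (1 / \<beta>) + 2 * (1 / \<alpha> + 1 / \<beta>) + 2"
  have Q: "(\<Sum>\<^sub>\<int> j. (octave_mass j + ennreal (2 powr (2 * of_int j)) * octave_mass j)) = int_sum octave_mass + (\<Sum>\<^sub>\<int> j. ennreal (2 powr (2 * of_int j)) * octave_mass j)"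
    unfolding int_sum_def by (rule nn_integral_add) auto
  have "ennreal (A * ln 2) \<le> ennreal (1 / (\<alpha> * \<beta>)) * int_sum octave_mass"
  proof (rule ennreal_le_of_vanishing_error)
    show "(\<Sum>\<^sub>\<int> j. (octave_mass j + ennreal (2 powr (2 * of_int j)) * octave_mass j)) < \<infinity>"
      unfolding Q using le_less_trans[OF sum_octave_mass_upper ennreal_less_top] sum_weighted_octave_mass_finite by simp
    fix n :: nat
    have "ennreal (A * ln 2) \<le> (\<Sum>\<^sub>\<int> j. mean (real (Suc n)) j)"
      by (rule frame_mean) simp
    also have "\<dots> \<le> (\<Sum>\<^sub>\<int> j. (ennreal (1 / (\<alpha> * \<beta>)) * octave_mass j + ennreal (?K / real (Suc n)) * (octave_mass j + ennreal (2 powr (2 * of_int j)) * octave_mass j)))"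
      by (intro int_sum_mono mean_le) simp
    also have "\<dots> = (\<Sum>\<^sub>\<int> j. ennreal (1 / (\<alpha> * \<beta>)) * octave_mass j) + (\<Sum>\<^sub>\<int> j. ennreal (?K / real (Suc n)) * (octave_mass j + ennreal (2 powr (2 * of_int j)) * octave_mass j))"
      unfolding int_sum_def by (rule nn_integral_add) auto
    finally show "ennreal (A * ln 2) \<le> ennreal (1 / (\<alpha> * \<beta>)) * int_sum octave_mass + ennreal (?K / real (Suc n)) * (\<Sum>\<^sub>\<int> j. (octave_mass j + ennreal (2 powr (2 * of_int j)) * octave_mass j))"
      unfolding int_sum_cmult .
  qed
  then have "ennreal (\<alpha> * \<beta>) * ennreal (A * ln 2) \<le> ennreal (\<alpha> * \<beta>) * (ennreal (1 / (\<alpha> * \<beta>)) * int_sum octave_mass)"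
    by (rule mult_left_mono) simp
  moreover have "ennreal (\<alpha> * \<beta>) * ennreal (A * ln 2) = ennreal (A * \<alpha> * \<beta> * ln 2)"
    using \<alpha> \<beta> by (subst ennreal_mult'[symmetric]) (simp_all add: mult_ac)
  ultimately show ?thesis unfolding cancel_covolume by simp
qed

lemma half_line_bounds:
  defines "I \<equiv> (\<integral>\<^sup>+x. (\<integral>\<^sup>+t. ennreal ((cmod (g (x, t)))\<^sup>2 * inverse \<bar>x\<bar>) \<partial>lborel) * indicator {0<..} (s * x) \<partial>lborel)"
  shows "ennreal (A * \<alpha> * \<beta> * ln 2) \<le> I" "I \<le> ennreal (B * \<alpha> * \<beta> * ln 2)"
proof -
  have "I = int_sum octave_mass"
    unfolding I_def sum_octave_mass
  proof (rule nn_integral_cong)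
    fix x :: real
    show "(\<integral>\<^sup>+t. ennreal ((cmod (g (x, t)))\<^sup>2 * inverse \<bar>x\<bar>) \<partial>lborel) * indicator {0<..} (s * x) =
       ennreal (1 / \<bar>x\<bar>) * \<gamma> x * indicator {0<..} (s * x)"
    proof (cases "x = 0")
      case False
      then have "(\<integral>\<^sup>+t. ennreal ((cmod (g (x, t)))\<^sup>2 * inverse \<bar>x\<bar>) \<partial>lborel) = (\<integral>\<^sup>+t. ennreal (1 / \<bar>x\<bar>) * ennreal ((cmod (g0 (x, t)))\<^sup>2) \<partial>lborel)"
        by (intro nn_integral_cong) (simp add: g0_eq ennreal_mult[symmetric] inverse_eq_divide)
      also have "\<dots> = ennreal (1 / \<bar>x\<bar>) * \<gamma> x"
        unfolding \<gamma>_def by (rule nn_integral_cmult) measurable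
      finally show ?thesis by simp
    qed simp
  qed
  then show "ennreal (A * \<alpha> * \<beta> * ln 2) \<le> I" "I \<le> ennreal (B * \<alpha> * \<beta> * ln 2)"
    using sum_octave_mass_lower sum_octave_mass_upper by simp_all
qed

end

theorem theorem4p2:
  fixes \<alpha> \<beta> A B :: real and g :: "real \<times> real \<Rightarrow> complex"
  assumes "\<alpha> > 0" and "\<beta> > 0"
    and "g \<in> L2 LamR"
    and "L2_frame LamR (Uhat_index \<alpha> \<beta> 1) (Uhat g) A B"
  shows "ennreal (A * \<alpha> * \<beta> * ln 2)
           \<le> (\<integral>\<^sup>+x\<in>{0<..}. (\<integral>\<^sup>+t. ennreal ((cmod (g (x, t)))\<^sup>2 * inverse x) \<partial>lborel) \<partial>lborel) \<and>
         (\<integral>\<^sup>+x\<in>{0<..}. (\<integral>\<^sup>+t. ennreal ((cmod (g (x, t)))\<^sup>2 * inverse x) \<partial>lborel) \<partial>lborel)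
           \<le> ennreal (B * \<alpha> * \<beta> * ln 2) \<and>
         ennreal (A * \<alpha> * \<beta> * ln 2)
           \<le> (\<integral>\<^sup>+x\<in>{..<0}. (\<integral>\<^sup>+t. ennreal ((cmod (g (x, t)))\<^sup>2 * inverse \<bar>x\<bar>) \<partial>lborel) \<partial>lborel) \<and>
         (\<integral>\<^sup>+x\<in>{..<0}. (\<integral>\<^sup>+t. ennreal ((cmod (g (x, t)))\<^sup>2 * inverse \<bar>x\<bar>) \<partial>lborel) \<partial>lborel)
           \<le> ennreal (B * \<alpha> * \<beta> * ln 2)"
proof -
  interpret pos: wavelet_frame \<alpha> \<beta> A B 1 g using assms by unfold_locales auto
  interpret neg: wavelet_frame \<alpha> \<beta> A B "-1" g using assms by unfold_locales auto
  have p: "(\<integral>\<^sup>+x\<in>{0<..}. (\<integral>\<^sup>+t. ennreal ((cmod (g (x, t)))\<^sup>2 * inverse x) \<partial>lborel) \<partial>lborel) =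
     (\<integral>\<^sup>+x. (\<integral>\<^sup>+t. ennreal ((cmod (g (x, t)))\<^sup>2 * inverse \<bar>x\<bar>) \<partial>lborel) * indicator {0<..} (1 * x) \<partial>lborel)"
    by (intro nn_integral_cong) (auto simp: indicator_def)
  have n: "(\<integral>\<^sup>+x\<in>{..<0}. (\<integral>\<^sup>+t. ennreal ((cmod (g (x, t)))\<^sup>2 * inverse \<bar>x\<bar>) \<partial>lborel) \<partial>lborel) =
     (\<integral>\<^sup>+x. (\<integral>\<^sup>+t. ennreal ((cmod (g (x, t)))\<^sup>2 * inverse \<bar>x\<bar>) \<partial>lborel) * indicator {0<..} (- 1 * x) \<partial>lborel)"
    by (intro nn_integral_cong) (auto simp: indicator_def)
  show ?thesis
    unfolding p n by (intro conjI pos.half_line_bounds neg.half_line_bounds)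
qed

end
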